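(* Let $X\in L^1(\mathbb{P}_0)$, let $\phi_1,\phi_2\in\Phi_0$ be lower-semicontinuous, let $r>0$, and assume the distribution of $X$ under $\mathbb{P}_0$ has a real-valued density function $f_0$. Let $$\rho^{s}_{\mathrm{oce},\mathbb{P}_0}(X)=\sup_{\{\mathbb{Q}:I_{\phi_2}(\mathbb{Q},\mathbb{P}_0)\leq r\}}\ \sup_{\{\bar{\mathbb{Q}}:\bar{\mathbb{Q}}\ll \mathbb{Q}\}}\mathbb{E}_{\bar{\mathbb{Q}}}[-X]-I_{\phi_1}(\bar{\mathbb{Q}},\mathbb{Q}),$$ $$\rho^{l}_{\mathrm{oce},\mathbb{P}_0}(X)=\sup_{\{\mathbb{Q}:\mathbb{Q}\ll \mathbb{P}_0\}}\ \sup_{\{\bar{\mathbb{Q}}:\bar{\mathbb{Q}}\ll \mathbb{Q}\}}\mathbb{E}_{\bar{\mathbb{Q}}}[-X]-I_{\phi_1}(\bar{\mathbb{Q}},\mathbb{Q})- I_{\phi_2}(\mathbb{Q},\mathbb{P}_0).$$ Then $\rho^{s}_{\mathrm{oce},\mathbb{P}_0}(X)<\infty$ if and only if there exist $\theta_1,\theta_2\in\mathbb{R}$ and $\lambda\ge0$ such that $$\int_{\mathbb{R}} \lambda \phi_2^*\left(\frac{\phi_1^*(\theta_2-x)+\theta_1}{\lambda}\right)f_0(x)\,\mathrm{d}x<\infty.$$ Similarly, $\rho^{l}_{\mathrm{oce},\mathbb{P}_0}(X)<\infty$ if and only if there exist $\theta_1,\theta_2\in\mathbb{R}$ such that $$\int_{\mathbb{R}}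 \phi_2^*\left(\phi_1^*(\theta_2-x)+\theta_1\right)f_0(x)\,\mathrm{d}x<\infty.$$
   Context: $\mathbb{P}_0$ is a given (nominal) probability measure on a measurable space $(\Omega,\mathcal{F})$; $\mathbb{Q},\bar{\mathbb{Q}}$ range over probability measures. Densities are with respect to a $\sigma$-finite measure $\mathrm{d}x$ on $\mathbb{R}$ (e.g. Lebesgue measure). $\Phi_0$ is the set of all convex functions $\phi:\mathbb{R}\to[0,\infty]$ with $\phi(1)=0$ whose effective domain $\{t:\phi(t)<\infty\}$ is contained in $[0,\infty)$ and contains a neighborhood of $1$. $I_\phi(\mathbb{Q},\mathbb{P})=\int_\Omega\phi\left(\frac{\mathrm{d}\mathbb{Q}}{\mathrm{d}\mathbb{P}}\right)\mathrm{d}\mathbb{P}$ if $\mathbb{Q}\ll\mathbb{P}$, and $+\infty$ otherwise. Conventions: $\phi(0)=\lim_{t\downarrow0}\phi(t)$, $0\phi(0/0)=0$, $0\phi(a/0)=a\lim_{t\to\infty}\phi(t)/t$ for $a>0$. $\phi^*(s)=\sup_{t\in\mathbb{R}}\{st-\phi(t)\}$ is the convex conjugate. Convention for $\lambda=0$: $0\phi^*(s/0)=0$ if $s\le0$ and $+\infty$ if $s>0$. *)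

theory Defs
  imports "HOL-Probability.Probability"
begin

text \<open>Difference in which the undefined expression \<open>\<infinity> - \<infinity>\<close> has value \<open>-\<infinity>\<close>, so that it never
  contributes to a supremum (the library's subtraction on \<^typ>\<open>ereal\<close> yields \<open>\<infinity>\<close> instead).
  It is only applied with \<open>b \<ge> 0\<close>.\<close>

definition ereal_diff_lower :: "ereal \<Rightarrow> ereal \<Rightarrow> ereal"  (infixl \<open>\<ominus>\<^sub>e\<close> 65) where
  "a \<ominus>\<^sub>e b = (if b = \<infinity> then -\<infinity> else a - b)"

text \<open>For the integrals of conjugates against the density of \<open>X\<close> the negative part is always finite:
  \<open>\<phi> 1 = 0\<close> gives \<open>\<phi>\<^sup>*(s) \<ge> s\<close>, so the integrand is at least \<open>(\<theta>\<^sub>1 + \<theta>\<^sub>2 - x) f\<^sub>0(x)\<close>, which is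
  integrable for \<open>X \<in> L\<^sup>1\<close>. The convention for \<open>\<infinity> - \<infinity>\<close> only matters for expectations of \<open>-X\<close>.\<close>

definition ext_integral :: "'a measure \<Rightarrow> ('a \<Rightarrow> ereal) \<Rightarrow> ereal" where
  "ext_integral M f =
     enn2ereal (\<integral>\<^sup>+x. e2ennreal (f x) \<partial>M) \<ominus>\<^sub>e enn2ereal (\<integral>\<^sup>+x. e2ennreal (- f x) \<partial>M)"

definition Phi0 :: "(real \<Rightarrow> ennreal) set" where
  "Phi0 = {\<phi>.
     (\<forall>x y u v. 0 \<le> u \<and> 0 \<le> v \<and> u + v = 1 \<longrightarrow>
        \<phi> (u * x + v * y) \<le> ennreal u * \<phi> x + ennreal v * \<phi> y) \<and>
     \<phi> 1 = 0 \<and>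
     {t. \<phi> t < \<infinity>} \<subseteq> {0..} \<and>
     1 \<in> interior {t. \<phi> t < \<infinity>}}"

definition lower_semicont :: "(real \<Rightarrow> ennreal) \<Rightarrow> bool" where
  "lower_semicont \<phi> \<longleftrightarrow> (\<forall>x. \<phi> x \<le> Liminf (at x) \<phi>)"

text \<open>Note the argument order of the library: \<open>absolutely_continuous P Q\<close> means \<open>Q \<lless> P\<close>, and
  \<open>RN_deriv P Q\<close> is \<open>dQ/dP\<close>, which is finite \<open>P\<close>-almost everywhere for probability measures.\<close>

definition phi_divergence :: "(real \<Rightarrow> ennreal) \<Rightarrow> 'a measure \<Rightarrow> 'a measure \<Rightarrow> ennreal" where
  "phi_divergence \<phi> Q P =
     (if absolutely_continuous P Q
      then \<integral>\<^sup>+\<omega>. \<phi> (enn2real (RN_deriv P Q \<omega>)) \<partial>P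
      else \<infinity>)"

text \<open>The conjugate takes extended arguments because it gets composed with another conjugate, which
  may be \<open>\<infinity>\<close>; for \<open>\<phi>\<close> in \<^const>\<open>Phi0\<close> its value at \<open>\<infinity>\<close> is \<open>\<infinity>\<close> (take \<open>t = 1\<close>).\<close>

definition convex_conjugate :: "(real \<Rightarrow> ennreal) \<Rightarrow> ereal \<Rightarrow> ereal" where
  "convex_conjugate \<phi> s = (SUP t::real. s * ereal t - enn2ereal (\<phi> t))"

text \<open>The expression \<open>\<lambda> \<phi>\<^sup>*(s/\<lambda>)\<close> for \<open>\<lambda> \<ge> 0\<close>.\<close>

definition scaled_conjugate :: "(real \<Rightarrow> ennreal) \<Rightarrow> real \<Rightarrow> ereal \<Rightarrow> ereal" where
  "scaled_conjugate \<phi> l s =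
     (if l = 0 then (if s \<le> 0 then 0 else \<infinity>)
      else ereal l * convex_conjugate \<phi> (s / ereal l))"

definition prob_measures :: "'a measure \<Rightarrow> 'a measure set" where
  "prob_measures M = {Q. prob_space Q \<and> sets Q = sets M}"

definition rho_oce_s ::
  "(real \<Rightarrow> ennreal) \<Rightarrow> (real \<Rightarrow> ennreal) \<Rightarrow> real \<Rightarrow> 'a measure \<Rightarrow> ('a \<Rightarrow> real) \<Rightarrow> ereal" where
  "rho_oce_s \<phi>\<^sub>1 \<phi>\<^sub>2 r P\<^sub>0 X =
     (SUP Q\<in>{Q \<in> prob_measures P\<^sub>0. phi_divergence \<phi>\<^sub>2 Q P\<^sub>0 \<le> ennreal r}.
      SUP Q'\<in>{Q' \<in> prob_measures P\<^sub>0. absolutely_continuous Q Q'}.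
        ext_integral Q' (\<lambda>\<omega>. ereal (- X \<omega>)) \<ominus>\<^sub>e enn2ereal (phi_divergence \<phi>\<^sub>1 Q' Q))"

definition rho_oce_l ::
  "(real \<Rightarrow> ennreal) \<Rightarrow> (real \<Rightarrow> ennreal) \<Rightarrow> 'a measure \<Rightarrow> ('a \<Rightarrow> real) \<Rightarrow> ereal" where
  "rho_oce_l \<phi>\<^sub>1 \<phi>\<^sub>2 P\<^sub>0 X =
     (SUP Q\<in>{Q \<in> prob_measures P\<^sub>0. absolutely_continuous P\<^sub>0 Q}.
      SUP Q'\<in>{Q' \<in> prob_measures P\<^sub>0. absolutely_continuous Q Q'}.
        ext_integral Q' (\<lambda>\<omega>. ereal (- X \<omega>)) \<ominus>\<^sub>e enn2ereal (phi_divergence \<phi>\<^sub>1 Q' Q)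
          \<ominus>\<^sub>e enn2ereal (phi_divergence \<phi>\<^sub>2 Q P\<^sub>0))"

end

theory Submission
  imports Defs
begin

text \<open>
  With \<open>q = dQ/dP\<^sub>0\<close> and \<open>t = dQ'/dQ\<close>, both risk measures are concave maximisation problems in \<open>(q, q t)\<close>
  with the linear constraints \<open>E[q] = 1\<close> and \<open>E[q t] = 1\<close> (and \<open>E[\<phi>\<^sub>2(q)] \<le> r\<close>). Two applications of
  the Fenchel--Young inequality bound the objective by the integral of the nested conjugate.
  Conversely, if the value is finite, restrict the problem to simple \<open>q\<close> and \<open>t\<close>. The constant pairs
  near \<open>(1, 1)\<close> are a Slater condition, so that a separating hyperplane in \<open>\<real>\<^sup>4\<close> yields multipliers
  for which the expected Lagrangian is bounded. The pointwise supremum of the Lagrangian is the nested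
  conjugate; it is the increasing limit of maxima over finitely many pairs \<open>(q, t)\<close>, each attained by a
  simple selection, so monotone convergence bounds its integral.
\<close>

subsection \<open>Convex conjugates\<close>

text \<open>Give the constraints \<open>E[q] = 1\<close>, \<open>E[q t] = 1\<close> and
  \<open>E[\<phi>\<^sub>2(q)] \<le> r\<close> the multipliers \<open>\<theta>\<^sub>1\<close>,
  \<open>\<theta>\<^sub>2\<close> and \<open>l\<close>. At \<open>X = x\<close> the Lagrangian is,
  up to constants, \<open>q (t (\<theta>\<^sub>2 - x) - \<phi>\<^sub>1(t) + \<theta>\<^sub>1) - l
  \<phi>\<^sub>2(q)\<close>. The supremum over \<open>t\<close> puts the conjugate of
  \<open>\<phi>\<^sub>1\<close> inside the bracket, and the supremum over \<open>q\<close> then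
  conjugates \<open>l \<phi>\<^sub>2\<close>. Infinite values shape both directions. In the
  separation argument densities are simple, so that all integrals are real, and \<open>q\<close> is
  positive, so that \<open>t\<close> can be recovered from \<open>(q, q t)\<close>. The upper bound
  concerns arbitrary measures, so its estimate is stated between nonnegative extended quantities,
  with negative terms moved to the other side or bounded by absolute values. The two directions meet
  in the positive part of the nested conjugate; its negative part is integrable because
  \<open>X\<close> is.\<close>

lemma Phi0_convexD:
  assumes "\<phi> \<in> Phi0" "0 \<le> u" "0 \<le> v" "u + v = 1"
  shows "\<phi> (u * x + v * y) \<le> ennreal u * \<phi> x + ennreal v * \<phi> y"
  using assms unfolding Phi0_def by blast

lemma Phi0_at_1: "\<phi> \<in> Phi0 \<Longrightarrow> \<phi> 1 = 0"
  unfolding Phi0_def by blast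

lemma Phi0_neg: "\<phi> \<in> Phi0 \<Longrightarrow> t < 0 \<Longrightarrow> \<phi> t = \<infinity>"
  unfolding Phi0_def by (force simp: less_top)

lemma Phi0_finite_near_1:
  assumes "\<phi> \<in> Phi0"
  obtains e where "e > 0" "\<forall>t. \<bar>t - 1\<bar> < e \<longrightarrow> \<phi> t < \<infinity>"
proof -
  have "1 \<in> interior {t. \<phi> t < \<infinity>}" using assms unfolding Phi0_def by blast
  then obtain e where "e > 0" "ball 1 e \<subseteq> {t. \<phi> t < \<infinity>}"
    unfolding mem_interior by blast
  then show thesis
    by (intro that[of e]) (auto simp: dist_real_def subset_eq abs_minus_commute)
qed

lemma Phi0_real_convex:
  assumes "\<phi> \<in> Phi0" "0 \<le> u" "0 \<le> v" "u + v = 1" "\<phi> x < \<infinity>" "\<phi> y < \<infinity>"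
  shows "\<phi> (u * x + v * y) < \<infinity>"
    and "enn2real (\<phi> (u * x + v * y)) \<le> u * enn2real (\<phi> x) + v * enn2real (\<phi> y)"
proof -
  have fin: "ennreal u * \<phi> x + ennreal v * \<phi> y < \<infinity>"
    using assms by (simp add: ennreal_mult_less_top)
  then show "\<phi> (u * x + v * y) < \<infinity>"
    using Phi0_convexD[OF assms(1-4)] le_less_trans by blast
  have "enn2real (\<phi> (u * x + v * y)) \<le> enn2real (ennreal u * \<phi> x + ennreal v * \<phi> y)"
    using Phi0_convexD[OF assms(1-4)] fin by (intro enn2real_mono) auto
  also have "\<dots> = u * enn2real (\<phi> x) + v * enn2real (\<phi> y)"
    using assms by (subst enn2real_plus) (auto simp: ennreal_mult_less_top enn2real_mult)
  finally show "enn2real (\<phi> (u * x + v * y)) \<le> u * enn2real (\<phi> x) + v * enn2real (\<phi> y)" .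
qed

text \<open>Sublevel sets of a convex function on the line are intervals, hence Borel.\<close>

lemma borel_measurable_Phi0:
  assumes "\<phi> \<in> Phi0"
  shows "\<phi> \<in> borel_measurable borel"
proof (rule borel_measurableI_le)
  fix c
  have "convex {x. \<phi> x \<le> c}"
    unfolding convex_def
  proof (intro ballI allI impI)
    fix x y :: real and u v :: real
    assume xy: "x \<in> {x. \<phi> x \<le> c}" "y \<in> {x. \<phi> x \<le> c}" and uv: "0 \<le> u" "0 \<le> v" "u + v = 1"
    have "\<phi> (u * x + v * y) \<le> ennreal u * \<phi> x + ennreal v * \<phi> y"
      using Phi0_convexD[OF assms uv] .
    also have "\<dots> \<le> ennreal u * c + ennreal v * c"
      using xy by (intro add_mono mult_left_mono) auto
    also have "\<dots> = ennreal (u + v) * c" using uv(1,2) by (simp only: distrib_right ennreal_plus)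
    finally show "u *\<^sub>R x + v *\<^sub>R y \<in> {x. \<phi> x \<le> c}" using uv by simp
  qed
  then have "is_interval {x. \<phi> x \<le> c}" by (simp add: is_interval_convex_1)
  then show "{x \<in> space borel. \<phi> x \<le> c} \<in> sets borel"
    by (simp add: real_interval_borel_measurable)
qed

lemma conjugate_ge:
  assumes "\<phi> \<in> Phi0" shows "s \<le> convex_conjugate \<phi> s"
  unfolding convex_conjugate_def
  by (rule SUP_upper2[of 1]) (use assms in \<open>simp_all add: Phi0_at_1 zero_ennreal.rep_eq\<close>)

text \<open>Only \<open>t \<ge> 0\<close> contributes to the supremum, since \<open>\<phi>\<close>
  is infinite on negative arguments. At \<open>s = -\<infinity>\<close> a negative \<open>t\<close>
  would give \<open>\<infinity> - \<infinity>\<close>, which is \<open>\<infinity>\<close> for the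
  subtraction used here; hence the exclusion.\<close>

lemma conjugate_mono:
  assumes "\<phi> \<in> Phi0" "s \<le> s'" "s \<noteq> -\<infinity>"
  shows "convex_conjugate \<phi> s \<le> convex_conjugate \<phi> s'"
  unfolding convex_conjugate_def
proof (rule SUP_mono)
  fix t :: real
  have "s * ereal t - enn2ereal (\<phi> t) \<le> s' * ereal t - enn2ereal (\<phi> t)"
  proof (cases "t < 0")
    case True
    then have "s * ereal t - enn2ereal (\<phi> t) = - \<infinity>"
      using Phi0_neg[OF assms(1)] assms(3) by (cases s) auto
    then show ?thesis by simp
  next
    case False
    then show ?thesis using assms(2)
      by (intro ereal_minus_mono ereal_mult_right_mono) auto
  qed
  then show "\<exists>t'\<in>UNIV. s * ereal t - enn2ereal (\<phi> t) \<le> s' * ereal t' - enn2ereal (\<phi> t')"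
    by blast
qed

lemma scaled_conjugate_ge:
  assumes "\<phi> \<in> Phi0" "l > 0" shows "s \<le> scaled_conjugate \<phi> l s"
proof -
  have "s = ereal l * (s / ereal l)" using assms(2) by (cases s) auto
  also have "\<dots> \<le> ereal l * convex_conjugate \<phi> (s / ereal l)"
    using assms by (intro ereal_mult_left_mono conjugate_ge) auto
  finally show ?thesis using assms(2) by (simp add: scaled_conjugate_def)
qed

lemma scaled_conjugate_mono:
  assumes "\<phi> \<in> Phi0" "s \<le> s'" "s \<noteq> -\<infinity>" "l \<ge> 0"
  shows "scaled_conjugate \<phi> l s \<le> scaled_conjugate \<phi> l s'"
proof (cases "l = 0")
  case True
  then show ?thesis using assms by (auto simp: scaled_conjugate_def)
next
  case False
  have "s / ereal l \<noteq> -\<infinity>" using False assms by (cases s) auto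
  moreover have "s / ereal l \<le> s' / ereal l"
    using False assms by (intro ereal_divide_right_mono) auto
  ultimately show ?thesis
    using False assms by (auto simp: scaled_conjugate_def intro!: ereal_mult_left_mono conjugate_mono)
qed

lemma antimono_borel_measurable_ereal:
  fixes g :: "real \<Rightarrow> ereal"
  assumes "\<And>x y. x \<le> y \<Longrightarrow> g y \<le> g x"
  shows "g \<in> borel_measurable borel"
proof (rule borel_measurableI_le)
  fix c
  have "is_interval {x. g x \<le> c}"
    unfolding is_interval_1 using assms order_trans by blast
  then show "{x \<in> space borel. g x \<le> c} \<in> sets borel"
    by (simp add: real_interval_borel_measurable)
qed

definition nested_conjugate ::
    "(real \<Rightarrow> ennreal) \<Rightarrow> (real \<Rightarrow> ennreal) \<Rightarrow> real \<Rightarrow> real \<Rightarrow> real \<Rightarrow> real \<Rightarrow> ereal" where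
  "nested_conjugate \<phi>\<^sub>1 \<phi>\<^sub>2 \<theta>\<^sub>1 \<theta>\<^sub>2 l x =
     scaled_conjugate \<phi>\<^sub>2 l (convex_conjugate \<phi>\<^sub>1 (ereal (\<theta>\<^sub>2 - x)) + ereal \<theta>\<^sub>1)"

lemma conjugate_real_gt_MInf:
  assumes "\<phi> \<in> Phi0"
  shows "convex_conjugate \<phi> (ereal s) > -\<infinity>"
  using conjugate_ge[OF assms, of "ereal s"] by (rule order.strict_trans2[rotated]) simp

lemma borel_measurable_nested_conjugate:
  assumes "\<phi>\<^sub>1 \<in> Phi0" "\<phi>\<^sub>2 \<in> Phi0" "l \<ge> 0"
  shows "nested_conjugate \<phi>\<^sub>1 \<phi>\<^sub>2 \<theta>\<^sub>1 \<theta>\<^sub>2 l \<in> borel_measurable borel"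
proof (rule antimono_borel_measurable_ereal)
  fix x y :: real assume "x \<le> y"
  then have "convex_conjugate \<phi>\<^sub>1 (ereal (\<theta>\<^sub>2 - y)) \<le> convex_conjugate \<phi>\<^sub>1 (ereal (\<theta>\<^sub>2 - x))"
    using assms by (intro conjugate_mono) auto
  then show "nested_conjugate \<phi>\<^sub>1 \<phi>\<^sub>2 \<theta>\<^sub>1 \<theta>\<^sub>2 l y \<le> nested_conjugate \<phi>\<^sub>1 \<phi>\<^sub>2 \<theta>\<^sub>1 \<theta>\<^sub>2 l x"
    unfolding nested_conjugate_def
    using assms conjugate_real_gt_MInf[OF assms(1), of "\<theta>\<^sub>2 - y"]
    by (intro scaled_conjugate_mono add_right_mono) auto
qed

text \<open>Take \<open>t = 1\<close> in the inner and \<open>q = 1\<close> in the outer supremum.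
  For \<open>l = 0\<close> the value is 0 or \<open>\<infinity>\<close>, and the absolute values
  make one bound cover both cases. As \<open>X\<close> is integrable, truncating the nested
  conjugate at 0 loses only a finite amount.\<close>

lemma nested_conjugate_ge:
  assumes "\<phi>\<^sub>1 \<in> Phi0" "\<phi>\<^sub>2 \<in> Phi0" "l \<ge> 0"
  shows "ereal (- (\<bar>x\<bar> + \<bar>\<theta>\<^sub>1\<bar> + \<bar>\<theta>\<^sub>2\<bar>)) \<le> nested_conjugate \<phi>\<^sub>1 \<phi>\<^sub>2 \<theta>\<^sub>1 \<theta>\<^sub>2 l x"
proof (cases "l = 0")
  case True
  moreover have "- \<bar>x\<bar> - \<bar>\<theta>\<^sub>1\<bar> \<le> \<bar>\<theta>\<^sub>2\<bar>" by linarith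
  ultimately show ?thesis by (simp add: nested_conjugate_def scaled_conjugate_def)
next
  case False
  have "ereal (- (\<bar>x\<bar> + \<bar>\<theta>\<^sub>1\<bar> + \<bar>\<theta>\<^sub>2\<bar>)) \<le> ereal (\<theta>\<^sub>2 - x) + ereal \<theta>\<^sub>1" by simp
  also have "\<dots> \<le> convex_conjugate \<phi>\<^sub>1 (ereal (\<theta>\<^sub>2 - x)) + ereal \<theta>\<^sub>1"
    by (intro add_right_mono conjugate_ge assms)
  also have "\<dots> \<le> nested_conjugate \<phi>\<^sub>1 \<phi>\<^sub>2 \<theta>\<^sub>1 \<theta>\<^sub>2 l x"
    unfolding nested_conjugate_def using False assms by (intro scaled_conjugate_ge) auto
  finally show ?thesis .
qed

text \<open>Lets the penalised risk measure be treated as the case \<open>l = 1\<close> of the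
  constrained one.\<close>

lemma convex_conjugate_eq_scaled: "convex_conjugate \<phi> s = scaled_conjugate \<phi> 1 s"
  by (simp add: scaled_conjugate_def flip: one_ereal_def)

section \<open>Fenchel-Young inequalities\<close>

lemma Fenchel_Young:
  assumes "\<phi> t < \<infinity>" "convex_conjugate \<phi> (ereal s) = ereal c"
  shows "s * t \<le> enn2real (\<phi> t) + c"
proof -
  have "ereal s * ereal t - enn2ereal (\<phi> t) \<le> ereal c"
    unfolding assms(2)[symmetric] convex_conjugate_def by (rule SUP_upper) simp
  moreover have "enn2ereal (\<phi> t) = ereal (enn2real (\<phi> t))"
    using assms(1) by (cases "\<phi> t" rule: ennreal_cases) (simp_all)
  ultimately show ?thesis by simp
qed

lemma scaled_Fenchel_Young:
  assumes "l \<ge> 0" "q \<ge> 0" "scaled_conjugate \<phi> l (ereal s) = ereal h" "l > 0 \<Longrightarrow> \<phi> q < \<infinity>"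
  shows "q * s \<le> l * enn2real (\<phi> q) + h"
proof (cases "l = 0")
  case True
  \<comment> \<open>By the convention for \<open>l = 0\<close>, a real value \<open>h\<close>
    excludes a positive argument.\<close>
  then have "s \<le> 0" "h = 0" using assms(3) by (auto simp: scaled_conjugate_def split: if_splits)
  then show ?thesis using True assms by (simp add: mult_nonneg_nonpos)
next
  case False
  then have "ereal l * convex_conjugate \<phi> (ereal (s / l)) = ereal h"
    using assms(3) by (simp add: scaled_conjugate_def)
  then have "convex_conjugate \<phi> (ereal (s / l)) = ereal (h / l)"
    using False by (cases "convex_conjugate \<phi> (ereal (s / l))") (auto split: if_splits)
  from Fenchel_Young[OF _ this, of q] have "s / l * q \<le> enn2real (\<phi> q) + h / l"
    using False assms by simp
  then show ?thesis using False assms(1) by (simp add: field_simps)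
qed

text \<open>Fenchel-Young for \<open>\<phi>\<^sub>1\<close> at \<open>t\<close>, multiplied by
  \<open>q\<close>, is added to the scaled inequality for \<open>\<phi>\<^sub>2\<close> at
  \<open>q\<close>. The left side is the positive part of \<open>- q t x\<close>; its negative part
  is the first term on the right. With only nonnegative terms, the inequality can be integrated
  without any integrability assumption.\<close>

lemma nested_Fenchel_Young:
  assumes "\<phi>\<^sub>1 \<in> Phi0" "\<phi>\<^sub>2 \<in> Phi0" "l \<ge> 0" "q \<ge> 0" "t \<ge> 0"
  shows "ennreal (q * t * (- x)) \<le> ennreal (q * t * x) + ennreal q * \<phi>\<^sub>1 t + ennreal l * \<phi>\<^sub>2 q
     + e2ennreal (nested_conjugate \<phi>\<^sub>1 \<phi>\<^sub>2 \<theta>\<^sub>1 \<theta>\<^sub>2 l x) + ennreal (\<bar>\<theta>\<^sub>1\<bar> * q) + ennreal (\<bar>\<theta>\<^sub>2\<bar> * (q * t))"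
    (is "?L \<le> ?R")
proof (cases "q = 0 \<or> ?R = \<infinity>")
  case True
  then show ?thesis by auto
next
  case False
  then have q: "q > 0" and fin1: "\<phi>\<^sub>1 t < \<infinity>" and fin2: "l > 0 \<Longrightarrow> \<phi>\<^sub>2 q < \<infinity>"
    and finh: "nested_conjugate \<phi>\<^sub>1 \<phi>\<^sub>2 \<theta>\<^sub>1 \<theta>\<^sub>2 l x \<noteq> \<infinity>"
    using assms by (auto simp: less_top ennreal_mult_eq_top_iff)
  obtain h where h: "nested_conjugate \<phi>\<^sub>1 \<phi>\<^sub>2 \<theta>\<^sub>1 \<theta>\<^sub>2 l x = ereal h"
    using finh nested_conjugate_ge[OF assms(1-3), of x \<theta>\<^sub>1 \<theta>\<^sub>2]
    by (cases "nested_conjugate \<phi>\<^sub>1 \<phi>\<^sub>2 \<theta>\<^sub>1 \<theta>\<^sub>2 l x") auto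
  define s where "s = convex_conjugate \<phi>\<^sub>1 (ereal (\<theta>\<^sub>2 - x)) + ereal \<theta>\<^sub>1"
  \<comment> \<open>The outer conjugate dominates its argument for \<open>l > 0\<close> and is
    infinite at \<open>\<infinity>\<close> for \<open>l = 0\<close>, so a real value
    \<open>h\<close> forces a finite inner conjugate.\<close>
  have "s \<noteq> \<infinity>"
    using h scaled_conjugate_ge[OF assms(2), of l s] assms(3)
    by (cases "l = 0") (auto simp: nested_conjugate_def s_def[symmetric] scaled_conjugate_def)
  then obtain c where c: "convex_conjugate \<phi>\<^sub>1 (ereal (\<theta>\<^sub>2 - x)) = ereal c"
    using conjugate_real_gt_MInf[OF assms(1), of "\<theta>\<^sub>2 - x"] unfolding s_def
    by (cases "convex_conjugate \<phi>\<^sub>1 (ereal (\<theta>\<^sub>2 - x))") auto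
  have "(\<theta>\<^sub>2 - x) * t \<le> enn2real (\<phi>\<^sub>1 t) + c"
    by (rule Fenchel_Young[OF fin1 c])
  then have "q * ((\<theta>\<^sub>2 - x) * t) \<le> q * (enn2real (\<phi>\<^sub>1 t) + c)"
    using assms by (intro mult_left_mono) auto
  moreover have "q * (c + \<theta>\<^sub>1) \<le> l * enn2real (\<phi>\<^sub>2 q) + h"
    using assms fin2 h by (intro scaled_Fenchel_Young) (auto simp: nested_conjugate_def c)
  moreover have "- (\<bar>\<theta>\<^sub>1\<bar> * q) \<le> \<theta>\<^sub>1 * q" "- (\<bar>\<theta>\<^sub>2\<bar> * (q * t)) \<le> \<theta>\<^sub>2 * (q * t)"
    using assms mult_right_mono[of "- \<bar>\<theta>\<^sub>1\<bar>" \<theta>\<^sub>1 q] mult_right_mono[of "- \<bar>\<theta>\<^sub>2\<bar>" \<theta>\<^sub>2 "q * t"] by auto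
  moreover have "h \<le> max 0 h" "q * t * x \<le> max 0 (q * t * x)" by auto
  ultimately have "q * t * (- x) \<le> max 0 (q * t * x) + q * enn2real (\<phi>\<^sub>1 t) + l * enn2real (\<phi>\<^sub>2 q)
      + max 0 h + \<bar>\<theta>\<^sub>1\<bar> * q + \<bar>\<theta>\<^sub>2\<bar> * (q * t)"
    by (simp add: algebra_simps)
  then have "?L \<le> ennreal (max 0 (q * t * x) + q * enn2real (\<phi>\<^sub>1 t) + l * enn2real (\<phi>\<^sub>2 q)
      + max 0 h + \<bar>\<theta>\<^sub>1\<bar> * q + \<bar>\<theta>\<^sub>2\<bar> * (q * t))"
    by (rule ennreal_leI)
  also have "\<dots> = ?R"
  proof -
    have "ennreal (l * enn2real (\<phi>\<^sub>2 q)) = ennreal l * \<phi>\<^sub>2 q"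
      using assms fin2 by (cases "l = 0") (auto simp: ennreal_mult')
    moreover have "ennreal (q * enn2real (\<phi>\<^sub>1 t)) = ennreal q * \<phi>\<^sub>1 t"
      using assms fin1 by (auto simp: ennreal_mult')
    ultimately show ?thesis
      using assms by (simp add: h)
  qed
  finally show ?thesis .
qed

subsection \<open>Multipliers and the pointwise Lagrangian\<close>

text \<open>Here \<open>c\<close> is the objective, \<open>a = 0\<close> and \<open>b = 0\<close>
  are the equality constraints and \<open>d \<le> r\<close> is the inequality constraint. The index
  set has no linear structure, so concavity is encoded by \<open>mix\<close>: some index meets the
  mixed equality values exactly and does at least as well in \<open>c\<close> and \<open>d\<close>.
  Regularity comes from \<open>interior\<close> for the equalities and from \<open>slater\<close>
  for the inequality.\<close>

lemma Lagrange_multipliers: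
  fixes a b c d :: "'i \<Rightarrow> real"
  assumes mix: "\<And>i j u. i \<in> S \<Longrightarrow> j \<in> S \<Longrightarrow> 0 \<le> u \<Longrightarrow> u \<le> 1 \<Longrightarrow>
      \<exists>k\<in>S. a k = u * a i + (1 - u) * a j \<and> b k = u * b i + (1 - u) * b j \<and>
        c k \<ge> u * c i + (1 - u) * c j \<and> d k \<le> u * d i + (1 - u) * d j"
    and slater: "i0 \<in> S" "a i0 = 0" "b i0 = 0" "d i0 < r"
    and interior: "e > 0" "\<And>x y. \<bar>x\<bar> < e \<Longrightarrow> \<bar>y\<bar> < e \<Longrightarrow> \<exists>i\<in>S. a i = x \<and> b i = y"
    and bound: "\<And>i. i \<in> S \<Longrightarrow> a i = 0 \<Longrightarrow> b i = 0 \<Longrightarrow> d i \<le> r \<Longrightarrow> c i \<le> V"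
  obtains \<alpha> \<beta> l C where "l \<ge> 0" "\<And>i. i \<in> S \<Longrightarrow> c i + \<alpha> * a i + \<beta> * b i - l * d i \<le> C"
proof -
  \<comment> \<open>Enlarging the image of \<open>S\<close> downward in \<open>c\<close> and upward
    in \<open>d\<close> turns the inequalities of \<open>mix\<close> into convexity, and later fixes
    the signs of \<open>G\<close> and \<open>D\<close>.\<close>
  define K where "K = {(x, y, z, w) |x y z w. \<exists>i\<in>S. x = a i \<and> y = b i \<and> z \<le> c i \<and> d i \<le> w}"
  have "convex K"
    unfolding convex_alt
  proof (intro ballI allI impI)
    fix p p' :: "real \<times> real \<times> real \<times> real" and v :: real
    assume pp: "p \<in> K" "p' \<in> K" and v: "0 \<le> v \<and> v \<le> 1"
    obtain i z w where i: "i \<in> S" "z \<le> c i" "d i \<le> w" and p: "p = (a i, b i, z, w)"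
      using pp(1) unfolding K_def by blast
    obtain j z' w' where j: "j \<in> S" "z' \<le> c j" "d j \<le> w'" and p': "p' = (a j, b j, z', w')"
      using pp(2) unfolding K_def by blast
    obtain k where k: "k \<in> S" "a k = (1 - v) * a i + v * a j" "b k = (1 - v) * b i + v * b j"
        "c k \<ge> (1 - v) * c i + v * c j" "d k \<le> (1 - v) * d i + v * d j"
      using mix[OF i(1) j(1), of "1 - v"] v by auto
    have "(1 - v) * z \<le> (1 - v) * c i" "v * z' \<le> v * c j"
      "(1 - v) * d i \<le> (1 - v) * w" "v * d j \<le> v * w'"
      using v i j by (auto intro!: mult_left_mono)
    then show "(1 - v) *\<^sub>R p + v *\<^sub>R p' \<in> K"
      using k unfolding K_def p p' by (auto intro!: bexI[of _ k])
  qed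
  moreover have "K \<noteq> {}" using slater(1) unfolding K_def by blast
  \<comment> \<open>The third coordinate exceeds every feasible objective value.\<close>
  moreover have "(0, 0, V + 1, r) \<notin> K" using bound unfolding K_def by force
  ultimately have "\<exists>n M. n \<noteq> 0 \<and> (\<forall>p\<in>K. inner n p \<le> M) \<and> (\<forall>p\<in>{(0, 0, V + 1, r)}. M \<le> inner n p)"
    by (intro separating_hyperplane_sets) auto
  then obtain n M where nM: "n \<noteq> 0" "\<forall>p\<in>K. inner n p \<le> M" "M \<le> inner n (0, 0, V + 1, r)"
    by blast
  obtain A B G D where n: "n = (A, B, G, D)" by (cases n)
  have n0: "(A, B, G, D) \<noteq> 0" and M: "M \<le> G * (V + 1) + D * r" using nM n by auto
  have sep: "A * a i + B * b i + G * z + D * w \<le> M" if "i \<in> S" "z \<le> c i" "d i \<le> w" for i z w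
  proof -
    have "(a i, b i, z, w) \<in> K" using that unfolding K_def by blast
    then have "inner n (a i, b i, z, w) \<le> M" using nM(2) by blast
    then show ?thesis by (simp add: n)
  qed
  \<comment> \<open>\<open>K\<close> is unbounded below in its third coordinate. The constant
    \<open>k\<close> is chosen so that lowering \<open>z\<close> by \<open>k\<close> would push the
    left side of \<open>sep\<close> above \<open>\<bar>M\<bar>\<close>. The sign of \<open>D\<close>
    follows likewise by raising \<open>w\<close>.\<close>
  have G: "G \<ge> 0"
  proof (rule ccontr)
    assume G: "\<not> G \<ge> 0"
    define k where "k = (\<bar>M\<bar> + \<bar>D * d i0\<bar> + \<bar>G * c i0\<bar> + 1) / (- G)"
    have "k \<ge> 0" using G unfolding k_def by (intro divide_nonneg_nonneg) auto
    then have "G * (c i0 - k) + D * d i0 \<le> M"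
      using sep[OF slater(1), of "c i0 - k" "d i0"] slater by simp
    moreover have "G * k = - (\<bar>M\<bar> + \<bar>D * d i0\<bar> + \<bar>G * c i0\<bar> + 1)" using G unfolding k_def by auto
    ultimately show False by (simp add: algebra_simps)
  qed
  have D: "D \<le> 0"
  proof (rule ccontr)
    assume D: "\<not> D \<le> 0"
    define k where "k = (\<bar>M\<bar> + \<bar>D * d i0\<bar> + \<bar>G * c i0\<bar> + 1) / D"
    have "k \<ge> 0" using D unfolding k_def by (intro divide_nonneg_nonneg) auto
    then have "G * c i0 + D * (d i0 + k) \<le> M"
      using sep[OF slater(1), of "c i0" "d i0 + k"] slater by simp
    moreover have "D * k = \<bar>M\<bar> + \<bar>D * d i0\<bar> + \<bar>G * c i0\<bar> + 1" using D unfolding k_def by auto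
    ultimately show False by (simp add: algebra_simps)
  qed
  \<comment> \<open>A vertical hyperplane is impossible: strict feasibility of \<open>i0\<close>
    would give \<open>D = 0\<close>, and then a linear form bounded by 0 on a neighbourhood of the
    origin would have to vanish, so the whole normal would be 0.\<close>
  have "G \<noteq> 0"
  proof
    assume G0: "G = 0"
    have "D * d i0 \<le> D * r" using sep[OF slater(1) order_refl order_refl] slater M G0 by simp
    then have D0: "D = 0" using D slater(4) by (auto simp: mult_le_cancel_left)
    have AB: "A * x + B * y \<le> 0" if xy: "\<bar>x\<bar> < e" "\<bar>y\<bar> < e" for x y
    proof -
      obtain i where "i \<in> S" "a i = x" "b i = y" using interior(2)[OF xy] by blast
      then show ?thesis using sep[of i "c i" "d i"] M G0 D0 by simp
    qed
    have "A * (e/2) = 0" using AB[of "e/2" 0] AB[of "- (e/2)" 0] interior(1) by simp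
    moreover have "B * (e/2) = 0" using AB[of 0 "e/2"] AB[of 0 "- (e/2)"] interior(1) by simp
    ultimately show False using n0 D0 G0 interior(1) by (simp add: zero_prod_def)
  qed
  with G have G: "G > 0" by simp
  show thesis
  proof (rule that[of "- D / G" "A / G" "B / G" "M / G"])
    show "0 \<le> - D / G" using D G by (intro divide_nonneg_nonneg) auto
    fix i assume "i \<in> S"
    from sep[OF this order_refl order_refl]
    have "(A * a i + B * b i + G * c i + D * d i) / G \<le> M / G"
      using G by (intro divide_right_mono) auto
    then show "c i + A / G * a i + B / G * b i - - D / G * d i \<le> M / G"
      using G by (simp add: add_divide_distrib algebra_simps)
  qed
qed

text \<open>The pair is \<open>(q, t)\<close>. Since \<open>enn2real\<close> sends
  \<open>\<infinity>\<close> to 0, the formula is meaningful only on \<open>pos_dom\<close>.\<close>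

definition lagrangian ::
    "(real \<Rightarrow> ennreal) \<Rightarrow> (real \<Rightarrow> ennreal) \<Rightarrow> real \<Rightarrow> real \<Rightarrow> real \<Rightarrow> real \<Rightarrow> real \<times> real \<Rightarrow> real" where
  "lagrangian \<phi>\<^sub>1 \<phi>\<^sub>2 \<theta>\<^sub>1 \<theta>\<^sub>2 l x p =
     fst p * snd p * (\<theta>\<^sub>2 - x) - fst p * enn2real (\<phi>\<^sub>1 (snd p)) + \<theta>\<^sub>1 * fst p - l * enn2real (\<phi>\<^sub>2 (fst p))"

text \<open>With \<open>q > 0\<close> the value \<open>t\<close> is determined by
  \<open>(q, q t)\<close>, so pairs can be mixed by dividing. The endpoint \<open>q = 0\<close> is
  regained as a limit in \<open>nested_conjugate_le\<close>.\<close>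

definition pos_dom :: "(real \<Rightarrow> ennreal) \<Rightarrow> (real \<Rightarrow> ennreal) \<Rightarrow> (real \<times> real) set" where
  "pos_dom \<phi>\<^sub>1 \<phi>\<^sub>2 = {q. 0 < q \<and> \<phi>\<^sub>2 q < \<infinity>} \<times> {t. \<phi>\<^sub>1 t < \<infinity>}"

lemma one_mem_pos_dom: "\<phi>\<^sub>1 \<in> Phi0 \<Longrightarrow> \<phi>\<^sub>2 \<in> Phi0 \<Longrightarrow> (1, 1) \<in> pos_dom \<phi>\<^sub>1 \<phi>\<^sub>2"
  by (simp add: pos_dom_def Phi0_at_1)

text \<open>The two suprema are undone one after the other, the inner one first. The claim can fail
  for \<open>l = 0\<close>: \<open>scaled_conjugate\<close> is then infinite at every positive
  argument, while a supremum over a bounded domain of \<open>\<phi>\<^sub>2\<close> stays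
  finite.\<close>

lemma nested_conjugate_le:
  assumes "\<phi>\<^sub>1 \<in> Phi0" "\<phi>\<^sub>2 \<in> Phi0" "l > 0"
    and le: "\<And>p. p \<in> pos_dom \<phi>\<^sub>1 \<phi>\<^sub>2 \<Longrightarrow> ereal (lagrangian \<phi>\<^sub>1 \<phi>\<^sub>2 \<theta>\<^sub>1 \<theta>\<^sub>2 l x p) \<le> Y"
  shows "nested_conjugate \<phi>\<^sub>1 \<phi>\<^sub>2 \<theta>\<^sub>1 \<theta>\<^sub>2 l x \<le> Y"
proof (cases "Y = \<infinity>")
  case True
  then show ?thesis by simp
next
  case False
  have "ereal (lagrangian \<phi>\<^sub>1 \<phi>\<^sub>2 \<theta>\<^sub>1 \<theta>\<^sub>2 l x (1, 1)) \<le> Y"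
    using assms by (intro le one_mem_pos_dom)
  with False obtain y where y: "Y = ereal y" by (cases Y) auto
  have ineq: "q * t * (\<theta>\<^sub>2 - x) - q * enn2real (\<phi>\<^sub>1 t) + \<theta>\<^sub>1 * q - l * enn2real (\<phi>\<^sub>2 q) \<le> y"
    if "q > 0" "\<phi>\<^sub>2 q < \<infinity>" "\<phi>\<^sub>1 t < \<infinity>" for q t
    using le[of "(q, t)"] that by (simp add: pos_dom_def lagrangian_def y)
  \<comment> \<open>For fixed \<open>q\<close> the bound is solved for the terms in
    \<open>t\<close>. The choice \<open>q = 1\<close>, where \<open>\<phi>\<^sub>2\<close> vanishes,
    then shows that the inner conjugate is real.\<close>
  have conj_le: "convex_conjugate \<phi>\<^sub>1 (ereal (\<theta>\<^sub>2 - x)) \<le> ereal ((y + l * enn2real (\<phi>\<^sub>2 q)) / q - \<theta>\<^sub>1)"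
    if q: "q > 0" "\<phi>\<^sub>2 q < \<infinity>" for q
    unfolding convex_conjugate_def
  proof (rule SUP_least)
    fix t :: real
    show "ereal (\<theta>\<^sub>2 - x) * ereal t - enn2ereal (\<phi>\<^sub>1 t) \<le> ereal ((y + l * enn2real (\<phi>\<^sub>2 q)) / q - \<theta>\<^sub>1)"
    proof (cases "\<phi>\<^sub>1 t" rule: ennreal_cases)
      case (real v)
      then show ?thesis using ineq[OF q, of t] q(1) by (simp add: field_simps)
    qed simp
  qed
  obtain s where s: "convex_conjugate \<phi>\<^sub>1 (ereal (\<theta>\<^sub>2 - x)) + ereal \<theta>\<^sub>1 = ereal s"
    using conj_le[of 1] Phi0_at_1[OF assms(2)] conjugate_real_gt_MInf[OF assms(1), of "\<theta>\<^sub>2 - x"]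
    by (cases "convex_conjugate \<phi>\<^sub>1 (ereal (\<theta>\<^sub>2 - x))") auto
  have pos: "s * q - l * enn2real (\<phi>\<^sub>2 q) \<le> y" if q: "q > 0" "\<phi>\<^sub>2 q < \<infinity>" for q
  proof -
    have "ereal s \<le> ereal ((y + l * enn2real (\<phi>\<^sub>2 q)) / q - \<theta>\<^sub>1) + ereal \<theta>\<^sub>1"
      unfolding s[symmetric] by (intro add_right_mono conj_le q)
    then show ?thesis using q(1) by (simp add: field_simps)
  qed
  text \<open>The point \<open>q = 0\<close> is approached along the segment to 1, where convexity controls \<open>\<phi>\<^sub>2\<close>.\<close>
  have zero: "- (l * enn2real (\<phi>\<^sub>2 0)) \<le> y" if fin: "\<phi>\<^sub>2 0 < \<infinity>"
  proof -
    have *: "s * u - l * ((1 - u) * enn2real (\<phi>\<^sub>2 0)) \<le> y" if u: "u \<in> {0<..<1}" for u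
    proof -
      have 1: "\<phi>\<^sub>2 u < \<infinity>" "enn2real (\<phi>\<^sub>2 u) \<le> (1 - u) * enn2real (\<phi>\<^sub>2 0)"
        using Phi0_real_convex[OF assms(2), of u "1 - u" 1 0] u fin Phi0_at_1[OF assms(2)] by auto
      have "l * enn2real (\<phi>\<^sub>2 u) \<le> l * ((1 - u) * enn2real (\<phi>\<^sub>2 0))"
        using 1 assms(3) by (intro mult_left_mono) auto
      then show ?thesis using pos[of u] 1 u by auto
    qed
    have "((\<lambda>u. s * u - l * ((1 - u) * enn2real (\<phi>\<^sub>2 0))) \<longlongrightarrow> s * 0 - l * ((1 - 0) * enn2real (\<phi>\<^sub>2 0))) (at_right 0)"
      by (intro tendsto_intros)
    then have "s * 0 - l * ((1 - 0) * enn2real (\<phi>\<^sub>2 0)) \<le> y"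
      by (rule tendsto_upperbound)
        (use * eventually_at_right_real[of 0 1] in \<open>auto elim!: eventually_mono\<close>)
    then show ?thesis by simp
  qed
  have "convex_conjugate \<phi>\<^sub>2 (ereal (s / l)) \<le> ereal (y / l)"
    unfolding convex_conjugate_def
  proof (rule SUP_least)
    fix q :: real
    show "ereal (s / l) * ereal q - enn2ereal (\<phi>\<^sub>2 q) \<le> ereal (y / l)"
    proof (cases "\<phi>\<^sub>2 q" rule: ennreal_cases)
      case (real v)
      then have "q \<ge> 0" using Phi0_neg[OF assms(2), of q] by force
      then have "s * q - l * v \<le> y"
        using real pos[of q] zero by (cases "q = 0") auto
      then have "(s * q - l * v) / l \<le> y / l" using assms(3) by (intro divide_right_mono) auto
      then show ?thesis using real assms(3) by (simp add: diff_divide_distrib)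
    qed simp
  qed
  then have "ereal l * convex_conjugate \<phi>\<^sub>2 (ereal (s / l)) \<le> ereal l * ereal (y / l)"
    using assms(3) by (intro ereal_mult_left_mono) auto
  then show ?thesis
    using assms(3) by (simp add: nested_conjugate_def scaled_conjugate_def s y)
qed

lemma integrable_simple_function_mult:
  fixes g h :: "'a \<Rightarrow> real"
  assumes "simple_function M g" "integrable M h"
  shows "integrable M (\<lambda>\<omega>. g \<omega> * h \<omega>)"
proof -
  have fin: "finite (g ` space M)" using assms(1) by (rule simple_functionD)
  then obtain K where K: "\<And>\<omega>. \<omega> \<in> space M \<Longrightarrow> \<bar>g \<omega>\<bar> \<le> K"
    using finite_imp_bounded[OF fin] unfolding bounded_iff by auto
  have [measurable]: "g \<in> borel_measurable M" using assms(1) by (rule borel_measurable_simple_function)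
  have [measurable]: "h \<in> borel_measurable M" using assms(2) by simp
  show ?thesis
  proof (rule Bochner_Integration.integrable_bound)
    show "integrable M (\<lambda>\<omega>. K * h \<omega>)" using assms(2) by simp
    have "\<bar>g \<omega> * h \<omega>\<bar> \<le> \<bar>K * h \<omega>\<bar>" if "\<omega> \<in> space M" for \<omega>
      using K[OF that] by (auto simp: abs_mult intro!: mult_right_mono)
    then show "AE \<omega> in M. norm (g \<omega> * h \<omega>) \<le> norm (K * h \<omega>)" by simp
  qed simp
qed

lemma (in prob_space) integrable_of_simple_function:
  fixes g :: "'a \<Rightarrow> real"
  assumes "simple_function M g" shows "integrable M g"
  using integrable_simple_function_mult[OF assms, of "\<lambda>_. 1"] by simp

text \<open>Separability is applied to the set of coefficients, in which the Lagrangian is affine, and not to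
  the set of arguments.\<close>

lemma lagrangian_countable_sup:
  assumes "\<phi>\<^sub>1 \<in> Phi0" "\<phi>\<^sub>2 \<in> Phi0"
  shows "\<exists>e :: nat \<Rightarrow> real \<times> real. e 0 = (1, 1) \<and> (\<forall>n. e n \<in> pos_dom \<phi>\<^sub>1 \<phi>\<^sub>2) \<and>
    (\<forall>x Y. (\<forall>n. ereal (lagrangian \<phi>\<^sub>1 \<phi>\<^sub>2 \<theta>\<^sub>1 \<theta>\<^sub>2 l x (e n)) \<le> Y) \<longrightarrow>
       (\<forall>p\<in>pos_dom \<phi>\<^sub>1 \<phi>\<^sub>2. ereal (lagrangian \<phi>\<^sub>1 \<phi>\<^sub>2 \<theta>\<^sub>1 \<theta>\<^sub>2 l x p) \<le> Y))"
proof -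
  define F where "F p = (fst p * snd p,
    \<theta>\<^sub>1 * fst p - fst p * enn2real (\<phi>\<^sub>1 (snd p)) - l * enn2real (\<phi>\<^sub>2 (fst p)))" for p :: "real \<times> real"
  have L: "lagrangian \<phi>\<^sub>1 \<phi>\<^sub>2 \<theta>\<^sub>1 \<theta>\<^sub>2 l x p = fst (F p) * (\<theta>\<^sub>2 - x) + snd (F p)" for x p
    unfolding F_def lagrangian_def by simp
  obtain T where T: "countable T" "T \<subseteq> F ` pos_dom \<phi>\<^sub>1 \<phi>\<^sub>2" "F ` pos_dom \<phi>\<^sub>1 \<phi>\<^sub>2 \<subseteq> closure T"
    by (rule separable)
  then obtain E where E: "countable E" "E \<subseteq> pos_dom \<phi>\<^sub>1 \<phi>\<^sub>2" "T = F ` E"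
    using countable_subset_image by metis
  define E' where "E' = insert (1, 1) E"
  have E': "countable E'" "E' \<noteq> {}" "E' \<subseteq> pos_dom \<phi>\<^sub>1 \<phi>\<^sub>2"
    unfolding E'_def using E one_mem_pos_dom[OF assms] by auto
  define e where "e n = (case n of 0 \<Rightarrow> (1, 1) | Suc m \<Rightarrow> from_nat_into E' m)" for n
  show ?thesis
  proof (rule exI[of _ e], intro conjI allI impI)
    show "e 0 = (1, 1)" by (simp add: e_def)
    show "e n \<in> pos_dom \<phi>\<^sub>1 \<phi>\<^sub>2" for n
      using one_mem_pos_dom[OF assms] E' from_nat_into[of E'] by (auto simp: e_def split: nat.split)
    fix x Y
    assume le: "\<forall>n. ereal (lagrangian \<phi>\<^sub>1 \<phi>\<^sub>2 \<theta>\<^sub>1 \<theta>\<^sub>2 l x (e n)) \<le> Y"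
    show "\<forall>p\<in>pos_dom \<phi>\<^sub>1 \<phi>\<^sub>2. ereal (lagrangian \<phi>\<^sub>1 \<phi>\<^sub>2 \<theta>\<^sub>1 \<theta>\<^sub>2 l x p) \<le> Y"
    proof (cases Y)
      case (real y)
      \<comment> \<open>For fixed \<open>x\<close> the bound describes a closed half-plane of
        coefficients, so it passes from the dense set \<open>T\<close> to its closure. No continuity
        of \<open>\<phi>\<^sub>1\<close> or \<open>\<phi>\<^sub>2\<close> enters.\<close>
      have "closed {v. fst v * (\<theta>\<^sub>2 - x) + snd v \<le> y}"
        by (intro closed_Collect_le continuous_intros)
      moreover have "T \<subseteq> {v. fst v * (\<theta>\<^sub>2 - x) + snd v \<le> y}"
      proof
        fix v assume "v \<in> T"
        then obtain p' where p': "p' \<in> E'" "v = F p'" using E unfolding E'_def by auto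
        obtain m where "from_nat_into E' m = p'" using from_nat_into_surj[OF E'(1) p'(1)] by blast
        then have "e (Suc m) = p'" by (simp add: e_def)
        then show "v \<in> {v. fst v * (\<theta>\<^sub>2 - x) + snd v \<le> y}" using le[rule_format, of "Suc m"] p' real by (simp add: L)
      qed
      ultimately have "closure T \<subseteq> {v. fst v * (\<theta>\<^sub>2 - x) + snd v \<le> y}" by (rule closure_minimal[rotated])
      then show ?thesis using T(3) real by (auto simp: L)
    qed (use le[rule_format, of 0] in auto)
  qed
qed

text \<open>Pairs \<open>(q, t)\<close> are mixed linearly in \<open>(q, q t)\<close>, in which the perspective \<open>q \<phi>(t)\<close> is jointly
  convex.\<close>

definition mix :: "real \<Rightarrow> real \<times> real \<Rightarrow> real \<times> real \<Rightarrow> real \<times> real" where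
  "mix u p p' = (u * fst p + (1 - u) * fst p',
     (u * fst p * snd p + (1 - u) * fst p' * snd p') / (u * fst p + (1 - u) * fst p'))"

lemma mix_pos_dom:
  assumes \<phi>: "\<phi>\<^sub>1 \<in> Phi0" "\<phi>\<^sub>2 \<in> Phi0" and p: "p \<in> pos_dom \<phi>\<^sub>1 \<phi>\<^sub>2" "p' \<in> pos_dom \<phi>\<^sub>1 \<phi>\<^sub>2"
    and u: "0 \<le> u" "u \<le> 1"
  shows "mix u p p' \<in> pos_dom \<phi>\<^sub>1 \<phi>\<^sub>2"
    and "fst (mix u p p') = u * fst p + (1 - u) * fst p'"
    and "fst (mix u p p') * snd (mix u p p') = u * (fst p * snd p) + (1 - u) * (fst p' * snd p')"
    and "fst (mix u p p') * enn2real (\<phi>\<^sub>1 (snd (mix u p p')))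
      \<le> u * (fst p * enn2real (\<phi>\<^sub>1 (snd p))) + (1 - u) * (fst p' * enn2real (\<phi>\<^sub>1 (snd p')))"
    and "enn2real (\<phi>\<^sub>2 (fst (mix u p p'))) \<le> u * enn2real (\<phi>\<^sub>2 (fst p)) + (1 - u) * enn2real (\<phi>\<^sub>2 (fst p'))"
proof -
  define w where "w = u * fst p + (1 - u) * fst p'"
  have pos: "fst p > 0" "fst p' > 0" and fin: "\<phi>\<^sub>2 (fst p) < \<infinity>" "\<phi>\<^sub>2 (fst p') < \<infinity>"
      "\<phi>\<^sub>1 (snd p) < \<infinity>" "\<phi>\<^sub>1 (snd p') < \<infinity>"
    using p by (auto simp: pos_dom_def)
  have w: "w > 0"
  proof (cases "u = 0")
    case False
    then have "u * fst p > 0" "(1 - u) * fst p' \<ge> 0" using u pos by auto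
    then show ?thesis unfolding w_def by linarith
  qed (use pos in \<open>simp add: w_def\<close>)
  \<comment> \<open>The second component of the mixture is a convex combination of
    \<open>snd p\<close> and \<open>snd p'\<close> with these weights. Multiplying the convexity
    inequality of \<open>\<phi>\<^sub>1\<close> by \<open>w\<close> cancels the denominators and
    gives the perspective inequality.\<close>
  define U V where "U = u * fst p / w" and "V = (1 - u) * fst p' / w"
  have UV: "U \<ge> 0" "V \<ge> 0" "U + V = 1"
    using w u pos unfolding U_def V_def by (auto simp flip: add_divide_distrib w_def)
  have fm: "fst (mix u p p') = w" and sm: "snd (mix u p p') = U * snd p + V * snd p'"
    by (simp_all add: mix_def w_def U_def V_def add_divide_distrib)
  show "mix u p p' \<in> pos_dom \<phi>\<^sub>1 \<phi>\<^sub>2"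
    using w Phi0_real_convex(1)[OF \<phi>(1) UV fin(3,4)]
      Phi0_real_convex(1)[OF \<phi>(2) _ _ _ fin(1,2), of u "1 - u"] u
    by (auto simp: pos_dom_def mem_Times_iff fm sm) (simp add: w_def)
  show "fst (mix u p p') = u * fst p + (1 - u) * fst p'" by (simp add: fm w_def)
  show "fst (mix u p p') * snd (mix u p p') = u * (fst p * snd p) + (1 - u) * (fst p' * snd p')"
    using w by (simp add: fm sm U_def V_def field_simps)
  have "w * enn2real (\<phi>\<^sub>1 (U * snd p + V * snd p'))
      \<le> w * (U * enn2real (\<phi>\<^sub>1 (snd p)) + V * enn2real (\<phi>\<^sub>1 (snd p')))"
    using w by (intro mult_left_mono Phi0_real_convex(2)[OF \<phi>(1) UV fin(3,4)]) auto
  also have "\<dots> = u * (fst p * enn2real (\<phi>\<^sub>1 (snd p))) + (1 - u) * (fst p' * enn2real (\<phi>\<^sub>1 (snd p')))"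
    using w by (simp add: U_def V_def field_simps)
  finally show "fst (mix u p p') * enn2real (\<phi>\<^sub>1 (snd (mix u p p')))
      \<le> u * (fst p * enn2real (\<phi>\<^sub>1 (snd p))) + (1 - u) * (fst p' * enn2real (\<phi>\<^sub>1 (snd p')))"
    by (simp add: fm sm)
  show "enn2real (\<phi>\<^sub>2 (fst (mix u p p'))) \<le> u * enn2real (\<phi>\<^sub>2 (fst p)) + (1 - u) * enn2real (\<phi>\<^sub>2 (fst p'))"
    using Phi0_real_convex(2)[OF \<phi>(2) _ _ _ fin(1,2), of u "1 - u"] u by (simp add: fm w_def)
qed

subsection \<open>Strong duality over simple densities\<close>

locale oce = prob_space P for P :: "'a measure" +
  fixes X :: "'a \<Rightarrow> real" and \<phi>\<^sub>1 \<phi>\<^sub>2 :: "real \<Rightarrow> ennreal"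
  assumes integrable_X: "integrable P X" and Phi0_1: "\<phi>\<^sub>1 \<in> Phi0" and Phi0_2: "\<phi>\<^sub>2 \<in> Phi0"
begin

text \<open>A plan \<open>p\<close> stands for the measures \<open>Q\<close>, \<open>Q'\<close> with \<open>dQ/dP = fst \<circ> p\<close> and \<open>dQ'/dQ = snd \<circ> p\<close>; their
  total masses are only constrained later.\<close>

definition plans :: "('a \<Rightarrow> real \<times> real) set" where
  "plans = {p. simple_function P p \<and> (\<forall>\<omega>. p \<omega> \<in> pos_dom \<phi>\<^sub>1 \<phi>\<^sub>2)}"

lemma measurable_X[measurable]: "X \<in> borel_measurable P"
  using integrable_X by simp

lemma simple_plan: "p \<in> plans \<Longrightarrow> simple_function P (\<lambda>\<omega>. g (p \<omega>))"
  by (auto simp: plans_def intro: simple_function_compose1)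

lemma integrable_plan:
  fixes g :: "real \<times> real \<Rightarrow> real"
  assumes "p \<in> plans"
  shows "integrable P (\<lambda>\<omega>. g (p \<omega>))" "integrable P (\<lambda>\<omega>. g (p \<omega>) * X \<omega>)"
proof -
  note simple_plan[OF assms, of g]
  then show "integrable P (\<lambda>\<omega>. g (p \<omega>))" "integrable P (\<lambda>\<omega>. g (p \<omega>) * X \<omega>)"
    by (auto intro: integrable_of_simple_function integrable_simple_function_mult integrable_X)
qed

lemma integrable_lagrangian:
  assumes "p \<in> plans"
  shows "integrable P (\<lambda>\<omega>. lagrangian \<phi>\<^sub>1 \<phi>\<^sub>2 \<theta>\<^sub>1 \<theta>\<^sub>2 l (X \<omega>) (p \<omega>))"
proof -
  have "integrable P (\<lambda>\<omega>. (fst (p \<omega>) * snd (p \<omega>) * \<theta>\<^sub>2 - fst (p \<omega>) * enn2real (\<phi>\<^sub>1 (snd (p \<omega>)))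
      + \<theta>\<^sub>1 * fst (p \<omega>) - l * enn2real (\<phi>\<^sub>2 (fst (p \<omega>)))) - fst (p \<omega>) * snd (p \<omega>) * X \<omega>)"
    by (intro Bochner_Integration.integrable_diff
       integrable_plan(1)[OF assms, where g = "\<lambda>p. fst p * snd p * \<theta>\<^sub>2 - fst p * enn2real (\<phi>\<^sub>1 (snd p))
         + \<theta>\<^sub>1 * fst p - l * enn2real (\<phi>\<^sub>2 (fst p))"]
       integrable_plan(2)[OF assms, where g = "\<lambda>p. fst p * snd p"])
  then show ?thesis by (simp add: lagrangian_def algebra_simps)
qed

lemma nested_conjugate_integral_finite:
  assumes "l > 0"
    and bound: "\<And>p. p \<in> plans \<Longrightarrow> (\<integral>\<omega>. lagrangian \<phi>\<^sub>1 \<phi>\<^sub>2 \<theta>\<^sub>1 \<theta>\<^sub>2 l (X \<omega>) (p \<omega>) \<partial>P) \<le> C"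
  shows "(\<integral>\<^sup>+\<omega>. e2ennreal (nested_conjugate \<phi>\<^sub>1 \<phi>\<^sub>2 \<theta>\<^sub>1 \<theta>\<^sub>2 l (X \<omega>)) \<partial>P) < \<infinity>"
proof -
  let ?L = "lagrangian \<phi>\<^sub>1 \<phi>\<^sub>2 \<theta>\<^sub>1 \<theta>\<^sub>2 l"
  obtain e :: "nat \<Rightarrow> real \<times> real" where e: "e 0 = (1, 1)" "\<forall>n. e n \<in> pos_dom \<phi>\<^sub>1 \<phi>\<^sub>2"
    "\<forall>x Y. (\<forall>n. ereal (?L x (e n)) \<le> Y) \<longrightarrow> (\<forall>p\<in>pos_dom \<phi>\<^sub>1 \<phi>\<^sub>2. ereal (?L x p) \<le> Y)"
    using lagrangian_countable_sup[OF Phi0_1 Phi0_2, of \<theta>\<^sub>1 \<theta>\<^sub>2 l] by (elim exE conjE)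
  \<comment> \<open>\<open>sel n \<omega>\<close> is a best pair among \<open>e 0, ..., e n\<close>
    at \<open>X \<omega>\<close>. Each stage changes the choice on a measurable set only, so the
    selection stays simple.\<close>
  define sel where "sel = rec_nat (\<lambda>\<omega>. e 0)
    (\<lambda>n p \<omega>. if ?L (X \<omega>) (p \<omega>) < ?L (X \<omega>) (e (Suc n)) then e (Suc n) else p \<omega>)"
  have sel_0: "sel 0 = (\<lambda>\<omega>. e 0)" and sel_Suc: "sel (Suc n) = (\<lambda>\<omega>.
      if ?L (X \<omega>) (sel n \<omega>) < ?L (X \<omega>) (e (Suc n)) then e (Suc n) else sel n \<omega>)" for n
    unfolding sel_def by simp_all
  have plan: "sel n \<in> plans" for n
  proof (induction n)
    case 0
    then show ?case using e(2) by (simp add: sel_0 plans_def)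
  next
    case (Suc n)
    have "(\<lambda>\<omega>. e (Suc n)) \<in> plans" using e(2) by (simp add: plans_def)
    then have [measurable]: "(\<lambda>\<omega>. ?L (X \<omega>) (e (Suc n))) \<in> borel_measurable P"
        "(\<lambda>\<omega>. ?L (X \<omega>) (sel n \<omega>)) \<in> borel_measurable P"
      using integrable_lagrangian Suc by (blast intro: borel_measurable_integrable)+
    have "{\<omega> \<in> space P. ?L (X \<omega>) (sel n \<omega>) < ?L (X \<omega>) (e (Suc n))} \<in> sets P" by measurable
    then show ?case using Suc e(2) unfolding sel_Suc plans_def
      by (auto intro!: simple_function_If)
  qed
  define m where "m n \<omega> = ?L (X \<omega>) (sel n \<omega>)" for n \<omega>
  have int: "integrable P (m n)" for n
    unfolding m_def by (rule integrable_lagrangian[OF plan])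
  have m_Suc: "m n \<omega> \<le> m (Suc n) \<omega>" for n \<omega> by (simp add: m_def sel_Suc)
  then have mono: "m i \<omega> \<le> m j \<omega>" if "i \<le> j" for i j \<omega>
    using that by (rule lift_Suc_mono_le[where f = "\<lambda>n. m n \<omega>"])
  have e_le: "?L (X \<omega>) (e n) \<le> m n \<omega>" for n \<omega>
    by (cases n) (simp_all add: m_def sel_0 sel_Suc)
  \<comment> \<open>The maxima may be negative, so \<open>m n\<close> is bounded by the sum of the
    nonnegative functions \<open>m n - m 0\<close> and \<open>\<bar>m 0\<bar>\<close>. The
    hypothesis \<open>bound\<close> controls the integral of the first one uniformly in
    \<open>n\<close>.\<close>
  let ?B = "ennreal (C - integral\<^sup>L P (m 0)) + ennreal (\<integral>\<omega>. \<bar>m 0 \<omega>\<bar> \<partial>P)"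
  have "(\<integral>\<^sup>+\<omega>. e2ennreal (nested_conjugate \<phi>\<^sub>1 \<phi>\<^sub>2 \<theta>\<^sub>1 \<theta>\<^sub>2 l (X \<omega>)) \<partial>P)
      \<le> (\<integral>\<^sup>+\<omega>. (SUP n. ennreal (m n \<omega>)) \<partial>P)"
  proof (rule nn_integral_mono)
    fix \<omega>
    let ?Y = "enn2ereal (SUP n. ennreal (m n \<omega>))"
    have "ereal (?L (X \<omega>) (e n)) \<le> ?Y" for n
    proof -
      have "?L (X \<omega>) (e n) \<le> max 0 (m n \<omega>)" using e_le[of \<omega> n] by simp
      then have "ereal (?L (X \<omega>) (e n)) \<le> ereal (max 0 (m n \<omega>))" by (simp only: ereal_less_eq)
      also have "\<dots> = enn2ereal (ennreal (m n \<omega>))" by (simp add: max_def enn2ereal_ennreal ennreal_neg zero_ennreal.rep_eq)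
      also have "\<dots> \<le> ?Y"
        unfolding less_eq_ennreal.rep_eq[symmetric] by (rule SUP_upper) simp
      finally show ?thesis .
    qed
    then have "nested_conjugate \<phi>\<^sub>1 \<phi>\<^sub>2 \<theta>\<^sub>1 \<theta>\<^sub>2 l (X \<omega>) \<le> ?Y"
      using e(3) by (intro nested_conjugate_le Phi0_1 Phi0_2 assms(1)) blast
    then show "e2ennreal (nested_conjugate \<phi>\<^sub>1 \<phi>\<^sub>2 \<theta>\<^sub>1 \<theta>\<^sub>2 l (X \<omega>)) \<le> (SUP n. ennreal (m n \<omega>))"
      using e2ennreal_mono by fastforce
  qed
  also have "\<dots> = (SUP n. \<integral>\<^sup>+\<omega>. ennreal (m n \<omega>) \<partial>P)"
    using int m_Suc
    by (intro nn_integral_monotone_convergence_SUP incseq_SucI le_funI ennreal_leI) auto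
  also have "\<dots> \<le> ?B"
  proof (rule SUP_least)
    fix n
    have "(\<integral>\<^sup>+\<omega>. ennreal (m n \<omega>) \<partial>P) \<le> (\<integral>\<^sup>+\<omega>. ennreal (m n \<omega> - m 0 \<omega>) + ennreal \<bar>m 0 \<omega>\<bar> \<partial>P)"
      using mono[of 0 n] by (intro nn_integral_mono) (auto simp flip: ennreal_plus intro!: ennreal_leI)
    also have "\<dots> = (\<integral>\<^sup>+\<omega>. ennreal (m n \<omega> - m 0 \<omega>) \<partial>P) + (\<integral>\<^sup>+\<omega>. ennreal \<bar>m 0 \<omega>\<bar> \<partial>P)"
      using int[of n] int[of 0] by (intro nn_integral_add) auto
    also have "\<dots> = ennreal (\<integral>\<omega>. m n \<omega> - m 0 \<omega> \<partial>P) + ennreal (\<integral>\<omega>. \<bar>m 0 \<omega>\<bar> \<partial>P)"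
      using int[of n] int[of 0] mono[of 0 n] by (subst (1 2) nn_integral_eq_integral) auto
    also have "\<dots> \<le> ?B"
      using int bound[OF plan[of n]] by (intro add_mono ennreal_leI) (auto simp: m_def[abs_def])
    finally show "(\<integral>\<^sup>+\<omega>. ennreal (m n \<omega>) \<partial>P) \<le> ?B" .
  qed
  finally show ?thesis by (rule le_less_trans) simp
qed

text \<open>When both masses are 1, the last three integrals are the expectation of \<open>X\<close>
  under \<open>Q'\<close> and the divergences of \<open>Q'\<close> from \<open>Q\<close> and of
  \<open>Q\<close> from \<open>P\<close>. The payoff carries no minus sign, so the objective reads
  \<open>- payoff p - cost\<^sub>1 p\<close>.\<close>

definition "mass p = (\<integral>\<omega>. fst (p \<omega>) \<partial>P)" for p :: "'a \<Rightarrow> real \<times> real"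
definition "mass' p = (\<integral>\<omega>. fst (p \<omega>) * snd (p \<omega>) \<partial>P)" for p :: "'a \<Rightarrow> real \<times> real"
definition "payoff p = (\<integral>\<omega>. fst (p \<omega>) * snd (p \<omega>) * X \<omega> \<partial>P)" for p :: "'a \<Rightarrow> real \<times> real"
definition "cost\<^sub>1 p = (\<integral>\<omega>. fst (p \<omega>) * enn2real (\<phi>\<^sub>1 (snd (p \<omega>))) \<partial>P)" for p
definition "cost\<^sub>2 p = (\<integral>\<omega>. enn2real (\<phi>\<^sub>2 (fst (p \<omega>))) \<partial>P)" for p :: "'a \<Rightarrow> real \<times> real"

lemma integral_lagrangian:
  assumes "p \<in> plans"
  shows "(\<integral>\<omega>. lagrangian \<phi>\<^sub>1 \<phi>\<^sub>2 \<theta>\<^sub>1 \<theta>\<^sub>2 l (X \<omega>) (p \<omega>) \<partial>P)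
    = \<theta>\<^sub>1 * mass p + \<theta>\<^sub>2 * mass' p - payoff p - cost\<^sub>1 p - l * cost\<^sub>2 p"
proof -
  note i = integrable_plan(1)[OF assms, where g = fst]
    integrable_plan(1)[OF assms, where g = "\<lambda>p. fst p * snd p"]
    integrable_plan(2)[OF assms, where g = "\<lambda>p. fst p * snd p"]
    integrable_plan(1)[OF assms, where g = "\<lambda>p. fst p * enn2real (\<phi>\<^sub>1 (snd p))"]
    integrable_plan(1)[OF assms, where g = "\<lambda>p. enn2real (\<phi>\<^sub>2 (fst p))"]
  have "lagrangian \<phi>\<^sub>1 \<phi>\<^sub>2 \<theta>\<^sub>1 \<theta>\<^sub>2 l (X \<omega>) (p \<omega>) = \<theta>\<^sub>1 * fst (p \<omega>) + \<theta>\<^sub>2 * (fst (p \<omega>) * snd (p \<omega>))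
      - fst (p \<omega>) * snd (p \<omega>) * X \<omega> - fst (p \<omega>) * enn2real (\<phi>\<^sub>1 (snd (p \<omega>)))
      - l * enn2real (\<phi>\<^sub>2 (fst (p \<omega>)))" for \<omega>
    unfolding lagrangian_def by (simp add: algebra_simps)
  then show ?thesis
    unfolding mass_def mass'_def payoff_def cost\<^sub>1_def cost\<^sub>2_def using i by simp
qed

text \<open>Supplies the hypothesis \<open>mix\<close> of \<open>Lagrange_multipliers\<close>:
  masses and payoff are linear in \<open>(q, q t)\<close>, and the costs inherit the pointwise
  convexity inequalities.\<close>

lemma mix_plans:
  assumes p: "p \<in> plans" "p' \<in> plans" and u: "0 \<le> u" "u \<le> 1"
  obtains k where "k \<in> plans" "mass k = u * mass p + (1 - u) * mass p'"
    "mass' k = u * mass' p + (1 - u) * mass' p'" "payoff k = u * payoff p + (1 - u) * payoff p'"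
    "cost\<^sub>1 k \<le> u * cost\<^sub>1 p + (1 - u) * cost\<^sub>1 p'" "cost\<^sub>2 k \<le> u * cost\<^sub>2 p + (1 - u) * cost\<^sub>2 p'"
proof -
  define k where "k \<omega> = mix u (p \<omega>) (p' \<omega>)" for \<omega>
  have dom: "p \<omega> \<in> pos_dom \<phi>\<^sub>1 \<phi>\<^sub>2" "p' \<omega> \<in> pos_dom \<phi>\<^sub>1 \<phi>\<^sub>2" for \<omega>
    using p by (auto simp: plans_def)
  have m: "k \<omega> \<in> pos_dom \<phi>\<^sub>1 \<phi>\<^sub>2" "fst (k \<omega>) = u * fst (p \<omega>) + (1 - u) * fst (p' \<omega>)"
      "fst (k \<omega>) * snd (k \<omega>) = u * (fst (p \<omega>) * snd (p \<omega>)) + (1 - u) * (fst (p' \<omega>) * snd (p' \<omega>))"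
      "fst (k \<omega>) * enn2real (\<phi>\<^sub>1 (snd (k \<omega>))) \<le> u * (fst (p \<omega>) * enn2real (\<phi>\<^sub>1 (snd (p \<omega>))))
        + (1 - u) * (fst (p' \<omega>) * enn2real (\<phi>\<^sub>1 (snd (p' \<omega>))))"
      "enn2real (\<phi>\<^sub>2 (fst (k \<omega>)))
        \<le> u * enn2real (\<phi>\<^sub>2 (fst (p \<omega>))) + (1 - u) * enn2real (\<phi>\<^sub>2 (fst (p' \<omega>)))" for \<omega>
    using mix_pos_dom[OF Phi0_1 Phi0_2 dom(1)[of \<omega>] dom(2)[of \<omega>] u] by (simp_all only: k_def)
  have k: "k \<in> plans"
    using p m(1) by (auto simp: plans_def k_def[abs_def] intro: simple_function_compose2)
  note i1 = integrable_plan(1)[where g = fst]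
    integrable_plan(1)[where g = "\<lambda>p. fst p * snd p"]
    integrable_plan(2)[where g = "\<lambda>p. fst p * snd p"]
  note i2 = integrable_plan(1)[where g = "\<lambda>p. fst p * enn2real (\<phi>\<^sub>1 (snd p))"]
    integrable_plan(1)[where g = "\<lambda>p. enn2real (\<phi>\<^sub>2 (fst p))"]
  show thesis
  proof (rule that[OF k])
    show "mass k = u * mass p + (1 - u) * mass p'"
      unfolding mass_def m(2) using i1[OF p(1)] i1[OF p(2)] by simp
    show "mass' k = u * mass' p + (1 - u) * mass' p'"
      unfolding mass'_def m(3) using i1[OF p(1)] i1[OF p(2)] by simp
    have "payoff k = (\<integral>\<omega>. u * (fst (p \<omega>) * snd (p \<omega>) * X \<omega>) + (1 - u) * (fst (p' \<omega>) * snd (p' \<omega>) * X \<omega>) \<partial>P)"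
      unfolding payoff_def m(3) by (simp add: algebra_simps)
    also have "\<dots> = u * payoff p + (1 - u) * payoff p'"
      unfolding payoff_def using i1[OF p(1)] i1[OF p(2)] by simp
    finally show "payoff k = u * payoff p + (1 - u) * payoff p'" .
    have "cost\<^sub>1 k \<le> (\<integral>\<omega>. u * (fst (p \<omega>) * enn2real (\<phi>\<^sub>1 (snd (p \<omega>))))
        + (1 - u) * (fst (p' \<omega>) * enn2real (\<phi>\<^sub>1 (snd (p' \<omega>)))) \<partial>P)"
      unfolding cost\<^sub>1_def using i2[OF p(1)] i2[OF p(2)] i2[OF k] m(4)
      by (intro integral_mono) auto
    also have "\<dots> = u * cost\<^sub>1 p + (1 - u) * cost\<^sub>1 p'"
      unfolding cost\<^sub>1_def using i2[OF p(1)] i2[OF p(2)] by simp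
    finally show "cost\<^sub>1 k \<le> u * cost\<^sub>1 p + (1 - u) * cost\<^sub>1 p'" .
    have "cost\<^sub>2 k \<le> (\<integral>\<omega>. u * enn2real (\<phi>\<^sub>2 (fst (p \<omega>))) + (1 - u) * enn2real (\<phi>\<^sub>2 (fst (p' \<omega>))) \<partial>P)"
      unfolding cost\<^sub>2_def using i2[OF p(1)] i2[OF p(2)] i2[OF k] m(5)
      by (intro integral_mono) auto
    also have "\<dots> = u * cost\<^sub>2 p + (1 - u) * cost\<^sub>2 p'"
      unfolding cost\<^sub>2_def using i2[OF p(1)] i2[OF p(2)] by simp
    finally show "cost\<^sub>2 k \<le> u * cost\<^sub>2 p + (1 - u) * cost\<^sub>2 p'" .
  qed
qed

lemma plan_nonneg:
  assumes "p \<in> plans"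
  shows "fst (p \<omega>) > 0" "snd (p \<omega>) \<ge> 0" "\<phi>\<^sub>1 (snd (p \<omega>)) < \<infinity>" "\<phi>\<^sub>2 (fst (p \<omega>)) < \<infinity>"
proof -
  have "p \<omega> \<in> pos_dom \<phi>\<^sub>1 \<phi>\<^sub>2" using assms by (simp add: plans_def)
  then show "fst (p \<omega>) > 0" "\<phi>\<^sub>1 (snd (p \<omega>)) < \<infinity>" "\<phi>\<^sub>2 (fst (p \<omega>)) < \<infinity>"
    by (auto simp: pos_dom_def)
  then show "snd (p \<omega>) \<ge> 0" using Phi0_neg[OF Phi0_1, of "snd (p \<omega>)"] by force
qed

text \<open>The plan's components agree with the Radon-Nikodym derivatives only almost everywhere,
  under \<open>P\<close> for \<open>Q\<close> and under \<open>Q\<close> for \<open>Q'\<close>;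
  these are exactly the measures against which the divergences integrate. As the densities are
  simple, \<open>X\<close> is integrable under \<open>Q'\<close> and no difference of infinities
  arises.\<close>

lemma plan_measures:
  assumes p: "p \<in> plans" and mass: "mass p = 1" "mass' p = 1"
  obtains Q Q' where "Q \<in> prob_measures P" "absolutely_continuous P Q"
    "Q' \<in> prob_measures P" "absolutely_continuous Q Q'"
    "phi_divergence \<phi>\<^sub>2 Q P = ennreal (cost\<^sub>2 p)" "phi_divergence \<phi>\<^sub>1 Q' Q = ennreal (cost\<^sub>1 p)"
    "ext_integral Q' (\<lambda>\<omega>. ereal (- X \<omega>)) = ereal (- payoff p)"
proof -
  note nonneg = plan_nonneg[OF p]
  have [measurable]: "(\<lambda>\<omega>. fst (p \<omega>)) \<in> borel_measurable P" "(\<lambda>\<omega>. snd (p \<omega>)) \<in> borel_measurable P"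
      "(\<lambda>\<omega>. \<phi>\<^sub>1 (snd (p \<omega>))) \<in> borel_measurable P"
    by (intro borel_measurable_simple_function simple_plan[OF p, where g = fst]
        simple_plan[OF p, where g = snd] simple_plan[OF p, where g = "\<lambda>p. \<phi>\<^sub>1 (snd p)"])+
  define Q where "Q = density P (\<lambda>\<omega>. ennreal (fst (p \<omega>)))"
  define Q' where "Q' = density Q (\<lambda>\<omega>. ennreal (snd (p \<omega>)))"
  have sets[measurable_cong]: "sets Q = sets P" "sets Q' = sets P" by (simp_all add: Q_def Q'_def)
  have intQ: "(\<integral>\<^sup>+\<omega>. g \<omega> \<partial>Q) = (\<integral>\<^sup>+\<omega>. ennreal (fst (p \<omega>)) * g \<omega> \<partial>P)"
    if [measurable]: "g \<in> borel_measurable P" for g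
    unfolding Q_def by (intro nn_integral_density) auto
  have intQ': "(\<integral>\<^sup>+\<omega>. g \<omega> \<partial>Q') = (\<integral>\<^sup>+\<omega>. ennreal (fst (p \<omega>) * snd (p \<omega>)) * g \<omega> \<partial>P)"
    if [measurable]: "g \<in> borel_measurable P" for g
    unfolding Q'_def using nonneg
    by (subst nn_integral_density) (auto simp: intQ ennreal_mult' mult.assoc less_imp_le)
  have "emeasure Q (space Q) = 1"
    using intQ[of "\<lambda>_. 1"] nn_integral_eq_integral[OF integrable_plan(1)[OF p, of fst]] nonneg mass
    by (simp add: mass_def less_imp_le)
  then interpret Q: prob_space Q by (rule prob_spaceI)
  have "emeasure Q' (space Q') = 1"
    using intQ'[of "\<lambda>_. 1"] nn_integral_eq_integral[OF integrable_plan(1)[OF p, of "\<lambda>p. fst p * snd p"]]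
      nonneg mass by (simp add: mass'_def less_imp_le)
  then interpret Q': prob_space Q' by (rule prob_spaceI)
  have ac: "absolutely_continuous P Q" "absolutely_continuous Q Q'"
    unfolding Q_def Q'_def by (intro absolutely_continuousI_density; measurable)+
  show thesis
  proof (rule that)
    show "Q \<in> prob_measures P" "Q' \<in> prob_measures P"
      using Q.prob_space_axioms Q'.prob_space_axioms sets by (auto simp: prob_measures_def)
    show "absolutely_continuous P Q" "absolutely_continuous Q Q'" by (fact ac)+
    have "AE \<omega> in P. ennreal (fst (p \<omega>)) = RN_deriv P Q \<omega>"
      by (rule RN_deriv_unique) (auto simp: Q_def)
    then have "AE \<omega> in P. \<phi>\<^sub>2 (enn2real (RN_deriv P Q \<omega>)) = ennreal (enn2real (\<phi>\<^sub>2 (fst (p \<omega>))))"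
      by eventually_elim (metis nonneg(1,4) enn2real_ennreal ennreal_enn2real less_imp_le infinity_ennreal_def)
    then have "phi_divergence \<phi>\<^sub>2 Q P = (\<integral>\<^sup>+\<omega>. ennreal (enn2real (\<phi>\<^sub>2 (fst (p \<omega>)))) \<partial>P)"
      unfolding phi_divergence_def using ac by (simp add: nn_integral_cong_AE)
    also have "\<dots> = ennreal (cost\<^sub>2 p)"
      unfolding cost\<^sub>2_def
      by (intro nn_integral_eq_integral integrable_plan(1)[OF p, of "\<lambda>p. enn2real (\<phi>\<^sub>2 (fst p))"]) auto
    finally show "phi_divergence \<phi>\<^sub>2 Q P = ennreal (cost\<^sub>2 p)" .
    have "AE \<omega> in Q. ennreal (snd (p \<omega>)) = RN_deriv Q Q' \<omega>"
      by (rule Q.RN_deriv_unique) (auto simp: Q'_def)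
    then have "AE \<omega> in Q. \<phi>\<^sub>1 (enn2real (RN_deriv Q Q' \<omega>)) = \<phi>\<^sub>1 (snd (p \<omega>))"
      by eventually_elim (metis nonneg(2) enn2real_ennreal)
    then have "phi_divergence \<phi>\<^sub>1 Q' Q = (\<integral>\<^sup>+\<omega>. \<phi>\<^sub>1 (snd (p \<omega>)) \<partial>Q)"
      unfolding phi_divergence_def using ac by (simp add: nn_integral_cong_AE)
    also have "\<dots> = (\<integral>\<^sup>+\<omega>. ennreal (fst (p \<omega>) * enn2real (\<phi>\<^sub>1 (snd (p \<omega>)))) \<partial>P)"
      using nonneg by (subst intQ) (auto intro!: nn_integral_cong simp: ennreal_mult' less_imp_le)
    also have "\<dots> = ennreal (cost\<^sub>1 p)"
      unfolding cost\<^sub>1_def using nonneg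
      by (intro nn_integral_eq_integral integrable_plan(1)[OF p, of "\<lambda>p. fst p * enn2real (\<phi>\<^sub>1 (snd p))"])
        (auto simp: less_imp_le)
    finally show "phi_divergence \<phi>\<^sub>1 Q' Q = ennreal (cost\<^sub>1 p)" .
    let ?W = "\<lambda>\<omega>. fst (p \<omega>) * snd (p \<omega>) * X \<omega>"
    have W: "integrable P ?W" by (rule integrable_plan(2)[OF p, of "\<lambda>p. fst p * snd p"])
    have qt: "fst (p \<omega>) * snd (p \<omega>) \<ge> 0" for \<omega> using nonneg[of \<omega>] by simp
    have 1: "(\<integral>\<^sup>+\<omega>. ennreal (X \<omega>) \<partial>Q') = (\<integral>\<^sup>+\<omega>. ennreal (?W \<omega>) \<partial>P)"
      using ennreal_mult'[OF qt] by (subst intQ') auto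
    have 2: "(\<integral>\<^sup>+\<omega>. ennreal (- X \<omega>) \<partial>Q') = (\<integral>\<^sup>+\<omega>. ennreal (- ?W \<omega>) \<partial>P)"
      using ennreal_mult'[OF qt, of _ "- X _"] by (subst intQ') auto
    obtain w where w: "w \<ge> 0" "(\<integral>\<^sup>+\<omega>. ennreal (?W \<omega>) \<partial>P) = ennreal w"
      using W unfolding real_integrable_def by (cases "\<integral>\<^sup>+\<omega>. ennreal (?W \<omega>) \<partial>P" rule: ennreal_cases) auto
    obtain w' where w': "w' \<ge> 0" "(\<integral>\<^sup>+\<omega>. ennreal (- ?W \<omega>) \<partial>P) = ennreal w'"
      using W unfolding real_integrable_def by (cases "\<integral>\<^sup>+\<omega>. ennreal (- ?W \<omega>) \<partial>P" rule: ennreal_cases) auto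
    have "payoff p = w - w'"
      unfolding payoff_def real_lebesgue_integral_def[OF W] using w w' by simp
    then show "ext_integral Q' (\<lambda>\<omega>. ereal (- X \<omega>)) = ereal (- payoff p)"
      using w w' by (simp add: ext_integral_def ereal_diff_lower_def 1 2)
  qed
qed

section \<open>Multipliers from finite risk measures\<close>

lemma rho_oce_s_plan_bound:
  assumes "rho_oce_s \<phi>\<^sub>1 \<phi>\<^sub>2 r P X < \<infinity>"
  shows "\<exists>V. \<forall>p\<in>plans. mass p = 1 \<longrightarrow> mass' p = 1 \<longrightarrow> cost\<^sub>2 p \<le> r \<longrightarrow> - payoff p - cost\<^sub>1 p \<le> V"
proof -
  have le: "ereal (- payoff p - cost\<^sub>1 p) \<le> rho_oce_s \<phi>\<^sub>1 \<phi>\<^sub>2 r P X"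
    if p: "p \<in> plans" "mass p = 1" "mass' p = 1" "cost\<^sub>2 p \<le> r" for p
  proof -
    obtain Q Q' where Q: "Q \<in> prob_measures P" "absolutely_continuous P Q"
        "Q' \<in> prob_measures P" "absolutely_continuous Q Q'"
        "phi_divergence \<phi>\<^sub>2 Q P = ennreal (cost\<^sub>2 p)" "phi_divergence \<phi>\<^sub>1 Q' Q = ennreal (cost\<^sub>1 p)"
        "ext_integral Q' (\<lambda>\<omega>. ereal (- X \<omega>)) = ereal (- payoff p)"
      using plan_measures[OF p(1-3)] .
    have "cost\<^sub>1 p \<ge> 0" unfolding cost\<^sub>1_def using plan_nonneg[OF p(1)]
      by (intro Bochner_Integration.integral_nonneg) (simp add: less_imp_le)
    then have "ereal (- payoff p - cost\<^sub>1 p) =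
        ext_integral Q' (\<lambda>\<omega>. ereal (- X \<omega>)) \<ominus>\<^sub>e enn2ereal (phi_divergence \<phi>\<^sub>1 Q' Q)"
      using Q by (simp add: ereal_diff_lower_def)
    also have "\<dots> \<le> rho_oce_s \<phi>\<^sub>1 \<phi>\<^sub>2 r P X"
      unfolding rho_oce_s_def
      by (rule SUP_upper2[of Q], use Q p(4) in \<open>simp add: ennreal_leI\<close>, rule SUP_upper) (use Q in simp)
    finally show ?thesis .
  qed
  show ?thesis
  proof (cases "rho_oce_s \<phi>\<^sub>1 \<phi>\<^sub>2 r P X")
    case (real V)
    then show ?thesis using le by (intro exI[of _ V]) simp
  next
    \<comment> \<open>Here \<open>le\<close> leaves no feasible plan, so any bound works.\<close>
    case MInf
    then show ?thesis using le by (intro exI[of _ 0]) force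
  qed (use assms in simp)
qed

lemma rho_oce_l_plan_bound:
  assumes "rho_oce_l \<phi>\<^sub>1 \<phi>\<^sub>2 P X < \<infinity>"
  shows "\<exists>V. \<forall>p\<in>plans. mass p = 1 \<longrightarrow> mass' p = 1 \<longrightarrow> - payoff p - cost\<^sub>1 p - cost\<^sub>2 p \<le> V"
proof -
  have le: "ereal (- payoff p - cost\<^sub>1 p - cost\<^sub>2 p) \<le> rho_oce_l \<phi>\<^sub>1 \<phi>\<^sub>2 P X"
    if p: "p \<in> plans" "mass p = 1" "mass' p = 1" for p
  proof -
    obtain Q Q' where Q: "Q \<in> prob_measures P" "absolutely_continuous P Q"
        "Q' \<in> prob_measures P" "absolutely_continuous Q Q'"
        "phi_divergence \<phi>\<^sub>2 Q P = ennreal (cost\<^sub>2 p)" "phi_divergence \<phi>\<^sub>1 Q' Q = ennreal (cost\<^sub>1 p)"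
        "ext_integral Q' (\<lambda>\<omega>. ereal (- X \<omega>)) = ereal (- payoff p)"
      using plan_measures[OF p] .
    have "cost\<^sub>1 p \<ge> 0" "cost\<^sub>2 p \<ge> 0" unfolding cost\<^sub>1_def cost\<^sub>2_def using plan_nonneg[OF p(1)]
      by (auto intro!: Bochner_Integration.integral_nonneg simp: less_imp_le)
    then have "ereal (- payoff p - cost\<^sub>1 p - cost\<^sub>2 p) =
        ext_integral Q' (\<lambda>\<omega>. ereal (- X \<omega>)) \<ominus>\<^sub>e enn2ereal (phi_divergence \<phi>\<^sub>1 Q' Q)
          \<ominus>\<^sub>e enn2ereal (phi_divergence \<phi>\<^sub>2 Q P)"
      using Q by (simp add: ereal_diff_lower_def)
    also have "\<dots> \<le> rho_oce_l \<phi>\<^sub>1 \<phi>\<^sub>2 P X"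
      unfolding rho_oce_l_def
      by (rule SUP_upper2[of Q], use Q in simp, rule SUP_upper) (use Q in simp)
    finally show ?thesis .
  qed
  show ?thesis
  proof (cases "rho_oce_l \<phi>\<^sub>1 \<phi>\<^sub>2 P X")
    case (real V)
    then show ?thesis using le by (intro exI[of _ V]) simp
  next
    case MInf
    then show ?thesis using le by (intro exI[of _ 0]) force
  qed (use assms in simp)
qed

text \<open>Prescribed masses \<open>1 + x\<close> and \<open>1 + y\<close> are realised by the
  constants \<open>q = 1 + x\<close> and \<open>t = (1 + y) / (1 + x)\<close>. This yields the
  hypothesis \<open>interior\<close> of \<open>Lagrange_multipliers\<close>.\<close>

lemma constant_plans:
  shows "\<exists>e>0. \<forall>x y. \<bar>x\<bar> < e \<longrightarrow> \<bar>y\<bar> < e \<longrightarrow> (\<exists>p\<in>plans. mass p - 1 = x \<and> mass' p - 1 = y)"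
proof -
  obtain e1 where e1: "e1 > 0" "\<And>t. \<bar>t - 1\<bar> < e1 \<Longrightarrow> \<phi>\<^sub>1 t < \<infinity>"
    using Phi0_finite_near_1[OF Phi0_1] by blast
  obtain e2 where e2: "e2 > 0" "\<And>t. \<bar>t - 1\<bar> < e2 \<Longrightarrow> \<phi>\<^sub>2 t < \<infinity>"
    using Phi0_finite_near_1[OF Phi0_2] by blast
  \<comment> \<open>The bound \<open>1/2\<close> keeps \<open>1 + x\<close> above
    \<open>1/2\<close>, so \<open>\<bar>t - 1\<bar> = \<bar>y - x\<bar> / (1 + x)\<close> is less
    than \<open>4 * e\<close>; this explains \<open>e1 / 4\<close>.\<close>
  define e where "e = min (1/2) (min e2 (e1 / 4))"
  have e: "e > 0" "e \<le> 1/2" "e \<le> e2" "e \<le> e1 / 4" using e1 e2 unfolding e_def by auto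
  show ?thesis
  proof (rule exI[of _ e], intro conjI allI impI e(1))
    fix x y :: real assume xy: "\<bar>x\<bar> < e" "\<bar>y\<bar> < e"
    then have x: "1 + x > 1/2" and diff: "\<bar>y - x\<bar> < 2 * e" using e by linarith+
    then have "(1 + y) / (1 + x) - 1 = (y - x) / (1 + x)" by (simp add: field_simps)
    then have "\<bar>(1 + y) / (1 + x) - 1\<bar> = \<bar>y - x\<bar> / (1 + x)" using x by (simp add: abs_divide)
    also have "\<dots> \<le> \<bar>y - x\<bar> / (1/2)" using x by (intro divide_left_mono) auto
    also have "\<dots> < e1" using diff e(4) by simp
    finally have "\<phi>\<^sub>1 ((1 + y) / (1 + x)) < \<infinity>" by (rule e1(2))
    moreover have "\<phi>\<^sub>2 (1 + x) < \<infinity>" using xy e by (intro e2(2)) auto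
    ultimately have "(\<lambda>_. (1 + x, (1 + y) / (1 + x))) \<in> plans"
      using x by (simp add: plans_def pos_dom_def)
    moreover have "mass (\<lambda>_. (1 + x, (1 + y) / (1 + x))) - 1 = x" by (simp add: mass_def prob_space)
    moreover have "mass' (\<lambda>_. (1 + x, (1 + y) / (1 + x))) - 1 = y"
      using x by (simp add: mass'_def prob_space)
    ultimately show "\<exists>p\<in>plans. mass p - 1 = x \<and> mass' p - 1 = y" by blast
  qed
qed

text \<open>The Slater point \<open>Q = Q' = P\<close>, whose cost 0 is strictly below
  \<open>r\<close>.\<close>

lemma trivial_plan:
  "(\<lambda>_. (1, 1)) \<in> plans" "mass (\<lambda>_. (1, 1)) = 1" "mass' (\<lambda>_. (1, 1)) = 1" "cost\<^sub>2 (\<lambda>_. (1, 1)) = 0"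
  using one_mem_pos_dom[OF Phi0_1 Phi0_2] Phi0_at_1[OF Phi0_2]
  by (simp_all add: plans_def mass_def mass'_def cost\<^sub>2_def prob_space)

lemma rho_oce_s_finiteD:
  assumes "rho_oce_s \<phi>\<^sub>1 \<phi>\<^sub>2 r P X < \<infinity>" "r > 0"
  obtains \<theta>\<^sub>1 \<theta>\<^sub>2 l where "l > 0"
    "(\<integral>\<^sup>+\<omega>. e2ennreal (nested_conjugate \<phi>\<^sub>1 \<phi>\<^sub>2 \<theta>\<^sub>1 \<theta>\<^sub>2 l (X \<omega>)) \<partial>P) < \<infinity>"
proof -
  obtain V where V: "\<And>p. p \<in> plans \<Longrightarrow> mass p = 1 \<Longrightarrow> mass' p = 1 \<Longrightarrow> cost\<^sub>2 p \<le> r \<Longrightarrow> - payoff p - cost\<^sub>1 p \<le> V"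
    using rho_oce_s_plan_bound[OF assms(1)] by blast
  obtain e where e: "e > 0" "\<And>x y. \<bar>x\<bar> < e \<Longrightarrow> \<bar>y\<bar> < e \<Longrightarrow> \<exists>p\<in>plans. mass p - 1 = x \<and> mass' p - 1 = y"
    using constant_plans by blast
  have mixing: "\<exists>k\<in>plans. mass k - 1 = u * (mass p - 1) + (1 - u) * (mass p' - 1) \<and>
      mass' k - 1 = u * (mass' p - 1) + (1 - u) * (mass' p' - 1) \<and>
      - payoff k - cost\<^sub>1 k \<ge> u * (- payoff p - cost\<^sub>1 p) + (1 - u) * (- payoff p' - cost\<^sub>1 p') \<and>
      cost\<^sub>2 k \<le> u * cost\<^sub>2 p + (1 - u) * cost\<^sub>2 p'"
    if "p \<in> plans" "p' \<in> plans" "0 \<le> u" "u \<le> 1" for p p' u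
    by (rule mix_plans[OF that], rule bexI) (auto simp: algebra_simps)
  obtain \<alpha> \<beta> l C where l: "l \<ge> 0" and C: "\<And>p. p \<in> plans \<Longrightarrow>
      (- payoff p - cost\<^sub>1 p) + \<alpha> * (mass p - 1) + \<beta> * (mass' p - 1) - l * cost\<^sub>2 p \<le> C"
    by (rule Lagrange_multipliers[of plans "\<lambda>p. mass p - 1" "\<lambda>p. mass' p - 1" "\<lambda>p. - payoff p - cost\<^sub>1 p"
        cost\<^sub>2 "\<lambda>_. (1, 1)" r e V, OF mixing]) (use trivial_plan assms(2) e V in auto)
  text \<open>A zero multiplier may be raised to 1 because \<open>cost\<^sub>2\<close> is nonnegative.\<close>
  have "(\<integral>\<omega>. lagrangian \<phi>\<^sub>1 \<phi>\<^sub>2 \<alpha> \<beta> (if l = 0 then 1 else l) (X \<omega>) (p \<omega>) \<partial>P) \<le> C + \<alpha> + \<beta>"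
    if p: "p \<in> plans" for p
  proof -
    have "cost\<^sub>2 p \<ge> 0" unfolding cost\<^sub>2_def by (intro Bochner_Integration.integral_nonneg) simp
    then have "l * cost\<^sub>2 p \<le> (if l = 0 then 1 else l) * cost\<^sub>2 p" by simp
    then show ?thesis using C[OF p] by (simp add: integral_lagrangian[OF p] algebra_simps)
  qed
  then show thesis
    using l by (intro that[of "if l = 0 then 1 else l" \<alpha> \<beta>] nested_conjugate_integral_finite) auto
qed

text \<open>The divergence of \<open>Q\<close> from \<open>P\<close> now belongs to the objective,
  with fixed multiplier 1. The inequality constraint is replaced by the trivial
  \<open>0 \<le> 1\<close>, so its multiplier drops out of the Lagrangian bound.\<close>

lemma rho_oce_l_finiteD:
  assumes "rho_oce_l \<phi>\<^sub>1 \<phi>\<^sub>2 P X < \<infinity>"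
  obtains \<theta>\<^sub>1 \<theta>\<^sub>2 where
    "(\<integral>\<^sup>+\<omega>. e2ennreal (nested_conjugate \<phi>\<^sub>1 \<phi>\<^sub>2 \<theta>\<^sub>1 \<theta>\<^sub>2 1 (X \<omega>)) \<partial>P) < \<infinity>"
proof -
  obtain V where V: "\<And>p. p \<in> plans \<Longrightarrow> mass p = 1 \<Longrightarrow> mass' p = 1 \<Longrightarrow> - payoff p - cost\<^sub>1 p - cost\<^sub>2 p \<le> V"
    using rho_oce_l_plan_bound[OF assms(1)] by blast
  obtain e where e: "e > 0" "\<And>x y. \<bar>x\<bar> < e \<Longrightarrow> \<bar>y\<bar> < e \<Longrightarrow> \<exists>p\<in>plans. mass p - 1 = x \<and> mass' p - 1 = y"
    using constant_plans by blast
  have mixing: "\<exists>k\<in>plans. mass k - 1 = u * (mass p - 1) + (1 - u) * (mass p' - 1) \<and>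
      mass' k - 1 = u * (mass' p - 1) + (1 - u) * (mass' p' - 1) \<and>
      - payoff k - cost\<^sub>1 k - cost\<^sub>2 k \<ge>
        u * (- payoff p - cost\<^sub>1 p - cost\<^sub>2 p) + (1 - u) * (- payoff p' - cost\<^sub>1 p' - cost\<^sub>2 p') \<and>
      0 \<le> u * (0::real) + (1 - u) * 0"
    if "p \<in> plans" "p' \<in> plans" "0 \<le> u" "u \<le> 1" for p p' u
    by (rule mix_plans[OF that], rule bexI) (auto simp: algebra_simps)
  obtain \<alpha> \<beta> l C where C: "\<And>p. p \<in> plans \<Longrightarrow>
      (- payoff p - cost\<^sub>1 p - cost\<^sub>2 p) + \<alpha> * (mass p - 1) + \<beta> * (mass' p - 1) - l * 0 \<le> C"
    by (rule Lagrange_multipliers[of plans "\<lambda>p. mass p - 1" "\<lambda>p. mass' p - 1"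
        "\<lambda>p. - payoff p - cost\<^sub>1 p - cost\<^sub>2 p" "\<lambda>_. 0" "\<lambda>_. (1, 1)" 1 e V, OF mixing])
      (use trivial_plan e V in auto)
  have "(\<integral>\<omega>. lagrangian \<phi>\<^sub>1 \<phi>\<^sub>2 \<alpha> \<beta> 1 (X \<omega>) (p \<omega>) \<partial>P) \<le> C + \<alpha> + \<beta>" if p: "p \<in> plans" for p
    using C[OF p] by (simp add: integral_lagrangian[OF p] algebra_simps)
  then show thesis by (intro that[of \<alpha> \<beta>] nested_conjugate_integral_finite) auto
qed

end

subsection \<open>Weak duality\<close>

lemma e2ennreal_mult_ereal:
  assumes "c \<ge> 0"
  shows "e2ennreal (a * ereal c) = e2ennreal a * ennreal c"
proof (cases a)
  case (real x)
  then show ?thesis using assms by (simp add: ennreal_mult'')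
next
  case PInf
  then show ?thesis using assms by (cases "c = 0") (auto simp: ennreal_top_mult)
next
  case MInf
  then show ?thesis using assms by (cases "c = 0") (auto simp: e2ennreal_neg)
qed

lemma ext_integral_less_PInf_iff:
  assumes "(\<integral>\<^sup>+x. e2ennreal (- f x) \<partial>M) < \<infinity>"
  shows "ext_integral M f < \<infinity> \<longleftrightarrow> (\<integral>\<^sup>+x. e2ennreal (f x) \<partial>M) < \<infinity>"
  using assms unfolding ext_integral_def ereal_diff_lower_def
  by (cases "\<integral>\<^sup>+x. e2ennreal (- f x) \<partial>M" "\<integral>\<^sup>+x. e2ennreal (f x) \<partial>M" rule: ennreal2_cases) auto

text \<open>Turns an estimate without subtraction into a bound on the objective. If \<open>b\<close>
  or \<open>i\<close> is infinite, the difference is \<open>-\<infinity>\<close> by the convention;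
  ordinary subtraction would give \<open>\<infinity>\<close> when \<open>a\<close> is infinite as
  well.\<close>

lemma ereal_diff_lower_le:
  assumes "a \<le> b + i + c"
  shows "enn2ereal a \<ominus>\<^sub>e enn2ereal b \<ominus>\<^sub>e enn2ereal i \<le> enn2ereal c"
  using assms unfolding ereal_diff_lower_def
  by (cases a; cases b; cases i; cases c) (auto simp: top_unique simp flip: ennreal_plus)

context oce
begin

text \<open>The negative part of the integrand is dominated by an affine function of
  \<open>\<bar>x\<bar>\<close> times the density, which is integrable with \<open>X\<close>. Hence
  only the positive part decides, and it is carried from \<open>\<mu>\<close> to \<open>P\<close> by
  the distribution of \<open>X\<close>.\<close>

lemma ext_integral_nested_conjugate_finite_iff:
  assumes "distributed P \<mu> X (\<lambda>x. ennreal (f\<^sub>0 x))" "sets \<mu> = sets borel" "\<And>x. 0 \<le> f\<^sub>0 x" "l \<ge> 0"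
  shows "ext_integral \<mu> (\<lambda>x. nested_conjugate \<phi>\<^sub>1 \<phi>\<^sub>2 \<theta>\<^sub>1 \<theta>\<^sub>2 l x * ereal (f\<^sub>0 x)) < \<infinity> \<longleftrightarrow>
    (\<integral>\<^sup>+\<omega>. e2ennreal (nested_conjugate \<phi>\<^sub>1 \<phi>\<^sub>2 \<theta>\<^sub>1 \<theta>\<^sub>2 l (X \<omega>)) \<partial>P) < \<infinity>"
proof -
  let ?g = "nested_conjugate \<phi>\<^sub>1 \<phi>\<^sub>2 \<theta>\<^sub>1 \<theta>\<^sub>2 l"
  let ?K = "\<lambda>x::real. \<bar>x\<bar> + \<bar>\<theta>\<^sub>1\<bar> + \<bar>\<theta>\<^sub>2\<bar>"
  have [measurable_cong]: "sets \<mu> = sets borel" by (fact assms(2))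
  have [measurable]: "?g \<in> borel_measurable borel"
    by (intro borel_measurable_nested_conjugate Phi0_1 Phi0_2 assms)
  have "(\<integral>\<^sup>+x. e2ennreal (- (?g x * ereal (f\<^sub>0 x))) \<partial>\<mu>) \<le> (\<integral>\<^sup>+x. ennreal (f\<^sub>0 x) * ennreal (?K x) \<partial>\<mu>)"
  proof (rule nn_integral_mono)
    fix x
    have "e2ennreal (- (?g x * ereal (f\<^sub>0 x))) = e2ennreal (- ?g x) * ennreal (f\<^sub>0 x)"
      using e2ennreal_mult_ereal[OF assms(3), of "- ?g x" x] by simp
    also have "\<dots> \<le> e2ennreal (ereal (?K x)) * ennreal (f\<^sub>0 x)"
      using nested_conjugate_ge[OF Phi0_1 Phi0_2 assms(4), of x \<theta>\<^sub>1 \<theta>\<^sub>2]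
      by (intro mult_right_mono e2ennreal_mono) (cases "?g x"; simp)+
    finally show "e2ennreal (- (?g x * ereal (f\<^sub>0 x))) \<le> ennreal (f\<^sub>0 x) * ennreal (?K x)"
      by (simp add: mult.commute)
  qed
  also have "\<dots> = (\<integral>\<^sup>+\<omega>. ennreal (?K (X \<omega>)) \<partial>P)"
    by (intro distributed_nn_integral[OF assms(1)]) measurable
  also have "\<dots> < \<infinity>"
    using integrable_X by (subst nn_integral_eq_integral) auto
  finally have "ext_integral \<mu> (\<lambda>x. ?g x * ereal (f\<^sub>0 x)) < \<infinity> \<longleftrightarrow>
      (\<integral>\<^sup>+x. e2ennreal (?g x * ereal (f\<^sub>0 x)) \<partial>\<mu>) < \<infinity>"
    by (rule ext_integral_less_PInf_iff)
  also have "(\<integral>\<^sup>+x. e2ennreal (?g x * ereal (f\<^sub>0 x)) \<partial>\<mu>) = (\<integral>\<^sup>+x. ennreal (f\<^sub>0 x) * e2ennreal (?g x) \<partial>\<mu>)"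
    by (intro nn_integral_cong) (simp add: e2ennreal_mult_ereal[OF assms(3)] mult.commute[of "ennreal _"])
  also have "\<dots> = (\<integral>\<^sup>+\<omega>. e2ennreal (?g (X \<omega>)) \<partial>P)"
    by (intro distributed_nn_integral[OF assms(1)]) measurable
  finally show ?thesis .
qed

text \<open>The integrated form of \<open>nested_Fenchel_Young\<close>. As \<open>Q\<close> and
  \<open>Q'\<close> have total mass 1, the terms in \<open>\<theta>\<^sub>1\<close> and
  \<open>\<theta>\<^sub>2\<close> integrate to constants independent of both measures.\<close>

lemma weak_duality:
  assumes Q: "Q \<in> prob_measures P" "absolutely_continuous P Q"
    and Q': "Q' \<in> prob_measures P" "absolutely_continuous Q Q'" and l: "l \<ge> 0"
  shows "(\<integral>\<^sup>+\<omega>. ennreal (- X \<omega>) \<partial>Q') \<le> (\<integral>\<^sup>+\<omega>. ennreal (X \<omega>) \<partial>Q') + phi_divergence \<phi>\<^sub>1 Q' Q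
    + ennreal l * phi_divergence \<phi>\<^sub>2 Q P
    + (\<integral>\<^sup>+\<omega>. e2ennreal (nested_conjugate \<phi>\<^sub>1 \<phi>\<^sub>2 \<theta>\<^sub>1 \<theta>\<^sub>2 l (X \<omega>)) \<partial>P) + ennreal \<bar>\<theta>\<^sub>1\<bar> + ennreal \<bar>\<theta>\<^sub>2\<bar>"
proof -
  have sets[measurable_cong]: "sets Q = sets P" "sets Q' = sets P"
    and "prob_space Q" "prob_space Q'"
    using Q Q' by (auto simp: prob_measures_def)
  then interpret Q: prob_space Q + Q': prob_space Q' by auto
  define q where "q \<omega> = enn2real (RN_deriv P Q \<omega>)" for \<omega>
  define t where "t \<omega> = enn2real (RN_deriv Q Q' \<omega>)" for \<omega>
  have nonneg: "q \<omega> \<ge> 0" "t \<omega> \<ge> 0" for \<omega> by (simp_all add: q_def t_def)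
  have [measurable]: "q \<in> borel_measurable P" unfolding q_def by measurable
  have "t \<in> borel_measurable Q" unfolding t_def by measurable
  then have [measurable]: "t \<in> borel_measurable P" by (simp cong: measurable_cong_sets add: sets)
  have [measurable]: "\<phi>\<^sub>1 \<in> borel_measurable borel" "\<phi>\<^sub>2 \<in> borel_measurable borel"
      "nested_conjugate \<phi>\<^sub>1 \<phi>\<^sub>2 \<theta>\<^sub>1 \<theta>\<^sub>2 l \<in> borel_measurable borel"
    by (intro borel_measurable_Phi0 borel_measurable_nested_conjugate Phi0_1 Phi0_2 l)+
  \<comment> \<open>Since \<open>enn2real\<close> would turn an infinite derivative into 0, almost
    everywhere finiteness is what makes \<open>q\<close>, and likewise \<open>t\<close>, genuine
    densities.\<close>
  have "AE \<omega> in P. RN_deriv P Q \<omega> \<noteq> \<infinity>"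
    by (intro RN_deriv_finite Q sets Q.sigma_finite_measure_axioms)
  then have "AE \<omega> in P. RN_deriv P Q \<omega> = ennreal (q \<omega>)"
    by eventually_elim (simp add: q_def less_top)
  then have "density P (\<lambda>\<omega>. ennreal (q \<omega>)) = density P (RN_deriv P Q)"
    by (intro density_cong) auto
  then have dQ: "Q = density P (\<lambda>\<omega>. ennreal (q \<omega>))" using density_RN_deriv[OF Q(2) sets(1)] by simp
  have "AE \<omega> in Q. RN_deriv Q Q' \<omega> \<noteq> \<infinity>"
    by (intro Q.RN_deriv_finite Q' Q'.sigma_finite_measure_axioms) (simp add: sets)
  then have "AE \<omega> in Q. RN_deriv Q Q' \<omega> = ennreal (t \<omega>)"
    by eventually_elim (simp add: t_def less_top)
  then have "density Q (\<lambda>\<omega>. ennreal (t \<omega>)) = density Q (RN_deriv Q Q')"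
    by (intro density_cong) auto
  then have dQ': "Q' = density Q (\<lambda>\<omega>. ennreal (t \<omega>))"
    using Q.density_RN_deriv[OF Q'(2)] sets by simp
  have intQ: "(\<integral>\<^sup>+\<omega>. g \<omega> \<partial>Q) = (\<integral>\<^sup>+\<omega>. ennreal (q \<omega>) * g \<omega> \<partial>P)"
    if [measurable]: "g \<in> borel_measurable P" for g
    unfolding dQ by (intro nn_integral_density) auto
  have intQ': "(\<integral>\<^sup>+\<omega>. g \<omega> \<partial>Q') = (\<integral>\<^sup>+\<omega>. ennreal (q \<omega> * t \<omega>) * g \<omega> \<partial>P)"
    if [measurable]: "g \<in> borel_measurable P" for g
    unfolding dQ' using nonneg
    by (subst nn_integral_density) (auto simp: intQ ennreal_mult' mult.assoc)
  have qt: "ennreal (q \<omega> * t \<omega> * x) = ennreal (q \<omega> * t \<omega>) * ennreal x" for \<omega> x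
    using nonneg by (simp add: ennreal_mult')
  let ?H = "\<lambda>\<omega>. e2ennreal (nested_conjugate \<phi>\<^sub>1 \<phi>\<^sub>2 \<theta>\<^sub>1 \<theta>\<^sub>2 l (X \<omega>))"
  have "(\<integral>\<^sup>+\<omega>. ennreal (- X \<omega>) \<partial>Q') = (\<integral>\<^sup>+\<omega>. ennreal (q \<omega> * t \<omega> * (- X \<omega>)) \<partial>P)"
    unfolding qt by (intro intQ') measurable
  also have "\<dots> \<le> (\<integral>\<^sup>+\<omega>. ennreal (q \<omega> * t \<omega> * X \<omega>) + ennreal (q \<omega>) * \<phi>\<^sub>1 (t \<omega>) + ennreal l * \<phi>\<^sub>2 (q \<omega>)
     + ?H \<omega> + ennreal (\<bar>\<theta>\<^sub>1\<bar> * q \<omega>) + ennreal (\<bar>\<theta>\<^sub>2\<bar> * (q \<omega> * t \<omega>)) \<partial>P)"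
    by (intro nn_integral_mono nested_Fenchel_Young Phi0_1 Phi0_2 l nonneg)
  also have "\<dots> = (\<integral>\<^sup>+\<omega>. ennreal (q \<omega> * t \<omega> * X \<omega>) \<partial>P) + (\<integral>\<^sup>+\<omega>. ennreal (q \<omega>) * \<phi>\<^sub>1 (t \<omega>) \<partial>P)
      + (\<integral>\<^sup>+\<omega>. ennreal l * \<phi>\<^sub>2 (q \<omega>) \<partial>P) + (\<integral>\<^sup>+\<omega>. ?H \<omega> \<partial>P)
      + (\<integral>\<^sup>+\<omega>. ennreal (\<bar>\<theta>\<^sub>1\<bar> * q \<omega>) \<partial>P) + (\<integral>\<^sup>+\<omega>. ennreal (\<bar>\<theta>\<^sub>2\<bar> * (q \<omega> * t \<omega>)) \<partial>P)"
    by (simp add: nn_integral_add)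
  also have "(\<integral>\<^sup>+\<omega>. ennreal (q \<omega> * t \<omega> * X \<omega>) \<partial>P) = (\<integral>\<^sup>+\<omega>. ennreal (X \<omega>) \<partial>Q')"
    unfolding qt by (intro intQ'[symmetric]) measurable
  also have "(\<integral>\<^sup>+\<omega>. ennreal (q \<omega>) * \<phi>\<^sub>1 (t \<omega>) \<partial>P) = phi_divergence \<phi>\<^sub>1 Q' Q"
    using Q'(2) by (simp add: phi_divergence_def intQ flip: t_def)
  also have "(\<integral>\<^sup>+\<omega>. ennreal l * \<phi>\<^sub>2 (q \<omega>) \<partial>P) = ennreal l * phi_divergence \<phi>\<^sub>2 Q P"
    using Q(2) by (simp add: phi_divergence_def nn_integral_cmult flip: q_def)
  also have "(\<integral>\<^sup>+\<omega>. ennreal (\<bar>\<theta>\<^sub>1\<bar> * q \<omega>) \<partial>P) = ennreal \<bar>\<theta>\<^sub>1\<bar>"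
    using intQ[of "\<lambda>_. 1"] Q.emeasure_space_1 by (simp add: ennreal_mult' nn_integral_cmult)
  also have "(\<integral>\<^sup>+\<omega>. ennreal (\<bar>\<theta>\<^sub>2\<bar> * (q \<omega> * t \<omega>)) \<partial>P) = ennreal \<bar>\<theta>\<^sub>2\<bar>"
    using intQ'[of "\<lambda>_. 1"] Q'.emeasure_space_1 by (subst ennreal_mult') (simp_all add: nn_integral_cmult)
  finally show ?thesis .
qed

section \<open>Finite risk measures from a finite conjugate integral\<close>

lemma rho_oce_s_finiteI:
  assumes H: "(\<integral>\<^sup>+\<omega>. e2ennreal (nested_conjugate \<phi>\<^sub>1 \<phi>\<^sub>2 \<theta>\<^sub>1 \<theta>\<^sub>2 l (X \<omega>)) \<partial>P) < \<infinity>" (is "?H < \<infinity>")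
    and l: "l \<ge> 0"
  shows "rho_oce_s \<phi>\<^sub>1 \<phi>\<^sub>2 r P X < \<infinity>"
proof -
  let ?C = "ennreal l * ennreal r + ?H + ennreal \<bar>\<theta>\<^sub>1\<bar> + ennreal \<bar>\<theta>\<^sub>2\<bar>"
  have "rho_oce_s \<phi>\<^sub>1 \<phi>\<^sub>2 r P X \<le> enn2ereal ?C"
    unfolding rho_oce_s_def
  proof (intro SUP_least)
    fix Q Q'
    assume "Q \<in> {Q \<in> prob_measures P. phi_divergence \<phi>\<^sub>2 Q P \<le> ennreal r}"
      and "Q' \<in> {Q' \<in> prob_measures P. absolutely_continuous Q Q'}"
    then have Q: "Q \<in> prob_measures P" "phi_divergence \<phi>\<^sub>2 Q P \<le> ennreal r"
      and Q': "Q' \<in> prob_measures P" "absolutely_continuous Q Q'" by auto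
    \<comment> \<open>Without absolute continuity the divergence is \<open>\<infinity>\<close>,
      which exceeds the real bound \<open>r\<close>.\<close>
    have "absolutely_continuous P Q"
      using Q(2) by (auto simp: phi_divergence_def top_unique split: if_splits)
    note weak_duality[OF Q(1) this Q' l, of \<theta>\<^sub>1 \<theta>\<^sub>2]
    also have "(\<integral>\<^sup>+\<omega>. ennreal (X \<omega>) \<partial>Q') + phi_divergence \<phi>\<^sub>1 Q' Q + ennreal l * phi_divergence \<phi>\<^sub>2 Q P
        + ?H + ennreal \<bar>\<theta>\<^sub>1\<bar> + ennreal \<bar>\<theta>\<^sub>2\<bar> \<le> (\<integral>\<^sup>+\<omega>. ennreal (X \<omega>) \<partial>Q') + phi_divergence \<phi>\<^sub>1 Q' Q
        + ennreal l * ennreal r + ?H + ennreal \<bar>\<theta>\<^sub>1\<bar> + ennreal \<bar>\<theta>\<^sub>2\<bar>"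
      by (intro add_mono mult_left_mono Q(2)) auto
    finally show "ext_integral Q' (\<lambda>\<omega>. ereal (- X \<omega>)) \<ominus>\<^sub>e enn2ereal (phi_divergence \<phi>\<^sub>1 Q' Q) \<le> enn2ereal ?C"
      unfolding ext_integral_def by (intro ereal_diff_lower_le) (simp add: add.assoc)
  qed
  also have "\<dots> < \<infinity>"
  proof -
    have "ennreal l * ennreal r < \<infinity>" by (simp add: ennreal_mult_less_top)
    then have "?C < \<infinity>" using H by simp
    then show ?thesis by (cases ?C rule: ennreal_cases) auto
  qed
  finally show ?thesis .
qed

lemma rho_oce_l_finiteI:
  assumes H: "(\<integral>\<^sup>+\<omega>. e2ennreal (nested_conjugate \<phi>\<^sub>1 \<phi>\<^sub>2 \<theta>\<^sub>1 \<theta>\<^sub>2 1 (X \<omega>)) \<partial>P) < \<infinity>" (is "?H < \<infinity>")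
  shows "rho_oce_l \<phi>\<^sub>1 \<phi>\<^sub>2 P X < \<infinity>"
proof -
  let ?C = "?H + ennreal \<bar>\<theta>\<^sub>1\<bar> + ennreal \<bar>\<theta>\<^sub>2\<bar>"
  have "rho_oce_l \<phi>\<^sub>1 \<phi>\<^sub>2 P X \<le> enn2ereal ?C"
    unfolding rho_oce_l_def
  proof (intro SUP_least)
    fix Q Q'
    assume "Q \<in> {Q \<in> prob_measures P. absolutely_continuous P Q}"
      and "Q' \<in> {Q' \<in> prob_measures P. absolutely_continuous Q Q'}"
    then have "(\<integral>\<^sup>+\<omega>. ennreal (- X \<omega>) \<partial>Q') \<le> (\<integral>\<^sup>+\<omega>. ennreal (X \<omega>) \<partial>Q') + phi_divergence \<phi>\<^sub>1 Q' Q
        + (phi_divergence \<phi>\<^sub>2 Q P + ?C)"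
      using weak_duality[of Q Q' 1 \<theta>\<^sub>1 \<theta>\<^sub>2] by (simp add: add.assoc)
    \<comment> \<open>The divergence of \<open>Q\<close> from \<open>P\<close> is first kept in the
      upper bound and subtracted only afterwards; if it is infinite, the outer difference is
      \<open>-\<infinity>\<close>.\<close>
    then have "ext_integral Q' (\<lambda>\<omega>. ereal (- X \<omega>)) \<ominus>\<^sub>e enn2ereal (phi_divergence \<phi>\<^sub>1 Q' Q)
        \<le> enn2ereal (phi_divergence \<phi>\<^sub>2 Q P + ?C)"
      unfolding ext_integral_def by (intro ereal_diff_lower_le) simp
    then show "ext_integral Q' (\<lambda>\<omega>. ereal (- X \<omega>)) \<ominus>\<^sub>e enn2ereal (phi_divergence \<phi>\<^sub>1 Q' Q)
        \<ominus>\<^sub>e enn2ereal (phi_divergence \<phi>\<^sub>2 Q P) \<le> enn2ereal ?C" (is "?E \<ominus>\<^sub>e enn2ereal ?d \<le> _")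
      by (cases ?E; cases ?d; cases ?C) (auto simp: ereal_diff_lower_def simp flip: ennreal_plus)
  qed
  also have "\<dots> < \<infinity>"
    using H by (cases ?H rule: ennreal_cases) (auto simp flip: ennreal_plus)
  finally show ?thesis .
qed

end

theorem corollary1:
  fixes P\<^sub>0 :: "'a measure" and X :: "'a \<Rightarrow> real"
    and \<phi>\<^sub>1 \<phi>\<^sub>2 :: "real \<Rightarrow> ennreal" and r :: real
    and \<mu> :: "real measure" and f\<^sub>0 :: "real \<Rightarrow> real"
  assumes "prob_space P\<^sub>0"
    and "integrable P\<^sub>0 X"
    and "\<phi>\<^sub>1 \<in> Phi0" and "lower_semicont \<phi>\<^sub>1"
    and "\<phi>\<^sub>2 \<in> Phi0" and "lower_semicont \<phi>\<^sub>2"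
    and "r > 0"
    and "sigma_finite_measure \<mu>" and "sets \<mu> = sets borel"
    and "\<And>x. 0 \<le> f\<^sub>0 x"
    and "distributed P\<^sub>0 \<mu> X (\<lambda>x. ennreal (f\<^sub>0 x))"
  shows "(rho_oce_s \<phi>\<^sub>1 \<phi>\<^sub>2 r P\<^sub>0 X < \<infinity> \<longleftrightarrow>
           (\<exists>\<theta>\<^sub>1 \<theta>\<^sub>2 l :: real. l \<ge> 0 \<and>
              ext_integral \<mu> (\<lambda>x. scaled_conjugate \<phi>\<^sub>2 l
                 (convex_conjugate \<phi>\<^sub>1 (ereal (\<theta>\<^sub>2 - x)) + ereal \<theta>\<^sub>1) * ereal (f\<^sub>0 x)) < \<infinity>)) \<and>
         (rho_oce_l \<phi>\<^sub>1 \<phi>\<^sub>2 P\<^sub>0 X < \<infinity> \<longleftrightarrow>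
           (\<exists>\<theta>\<^sub>1 \<theta>\<^sub>2 :: real.
              ext_integral \<mu> (\<lambda>x. convex_conjugate \<phi>\<^sub>2
                 (convex_conjugate \<phi>\<^sub>1 (ereal (\<theta>\<^sub>2 - x)) + ereal \<theta>\<^sub>1) * ereal (f\<^sub>0 x)) < \<infinity>))"
proof -
  interpret oce P\<^sub>0 X \<phi>\<^sub>1 \<phi>\<^sub>2
    by (intro oce.intro oce_axioms.intro assms)
  note iff = ext_integral_nested_conjugate_finite_iff[OF assms(11,9,10)]
  show ?thesis
    unfolding convex_conjugate_eq_scaled[of \<phi>\<^sub>2] nested_conjugate_def[symmetric]
  proof (intro conjI iffI)
    assume "rho_oce_s \<phi>\<^sub>1 \<phi>\<^sub>2 r P\<^sub>0 X < \<infinity>"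
    then obtain \<theta>\<^sub>1 \<theta>\<^sub>2 l where "l > 0"
        "(\<integral>\<^sup>+\<omega>. e2ennreal (nested_conjugate \<phi>\<^sub>1 \<phi>\<^sub>2 \<theta>\<^sub>1 \<theta>\<^sub>2 l (X \<omega>)) \<partial>P\<^sub>0) < \<infinity>"
      using assms(7) by (rule rho_oce_s_finiteD)
    then show "\<exists>\<theta>\<^sub>1 \<theta>\<^sub>2 l. l \<ge> 0 \<and>
        ext_integral \<mu> (\<lambda>x. nested_conjugate \<phi>\<^sub>1 \<phi>\<^sub>2 \<theta>\<^sub>1 \<theta>\<^sub>2 l x * ereal (f\<^sub>0 x)) < \<infinity>"
      using iff less_imp_le by blast
  next
    assume "\<exists>\<theta>\<^sub>1 \<theta>\<^sub>2 l. l \<ge> 0 \<and>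
        ext_integral \<mu> (\<lambda>x. nested_conjugate \<phi>\<^sub>1 \<phi>\<^sub>2 \<theta>\<^sub>1 \<theta>\<^sub>2 l x * ereal (f\<^sub>0 x)) < \<infinity>"
    then show "rho_oce_s \<phi>\<^sub>1 \<phi>\<^sub>2 r P\<^sub>0 X < \<infinity>"
      using iff rho_oce_s_finiteI by blast
  next
    assume "rho_oce_l \<phi>\<^sub>1 \<phi>\<^sub>2 P\<^sub>0 X < \<infinity>"
    then obtain \<theta>\<^sub>1 \<theta>\<^sub>2 where
        "(\<integral>\<^sup>+\<omega>. e2ennreal (nested_conjugate \<phi>\<^sub>1 \<phi>\<^sub>2 \<theta>\<^sub>1 \<theta>\<^sub>2 1 (X \<omega>)) \<partial>P\<^sub>0) < \<infinity>"
      by (rule rho_oce_l_finiteD)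
    then show "\<exists>\<theta>\<^sub>1 \<theta>\<^sub>2.
        ext_integral \<mu> (\<lambda>x. nested_conjugate \<phi>\<^sub>1 \<phi>\<^sub>2 \<theta>\<^sub>1 \<theta>\<^sub>2 1 x * ereal (f\<^sub>0 x)) < \<infinity>"
      using iff[of 1] by auto
  next
    assume "\<exists>\<theta>\<^sub>1 \<theta>\<^sub>2.
        ext_integral \<mu> (\<lambda>x. nested_conjugate \<phi>\<^sub>1 \<phi>\<^sub>2 \<theta>\<^sub>1 \<theta>\<^sub>2 1 x * ereal (f\<^sub>0 x)) < \<infinity>"
    then show "rho_oce_l \<phi>\<^sub>1 \<phi>\<^sub>2 P\<^sub>0 X < \<infinity>"
      using iff[of 1] rho_oce_l_finiteI by auto
  qed
qed

end
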